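(* Let $(Y,\bullet)$ be a pointed topological space. The equivalence relation $\sim$ on $\mathrm{NAP}_Y$ generated by the reductions $T\sim T_{ij}$ is compatible with the operad maps of $\mathrm{NAP}_Y$. Hence the quotient collection $\mathrm{BCact}_Y$ has an operad structure inherited from $\mathrm{NAP}_Y$. Furthermore, the equivalence relation $\sim$ is generated, as an operad ideal, by the single relation (for $y\in Y$) in arity $3$ $$\bigl(1\xrightarrow{\,y\,}2\xrightarrow{\,\bullet\,}3\bigr)\;=\;\bigl(2\xleftarrow{\,y\,}1\xrightarrow{\,y\,}3\bigr),$$ where the left side is the $Y$-tree with root $1$ and edges $1\to2$ labelled $y$, $2\to 3$ labelled $\bullet$, and the right side is the $Y$-tree with root $1$ and edges $1\to2$ and $1\to3$, both labelled $y$.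
   Context: Edges of a rooted tree are oriented away from the root; $i\to j$ denotes an edge from $i$ to $j$. $[n]=\{1,\dots,n\}$. A $Y$-tree is a rooted tree with every edge labelled by an element of $Y$. $\mathrm{NAP}_Y(n)$ is the set of $Y$-trees with vertex set $[n]$, topologised as the disjoint union over rooted trees $T$ on $[n]$ of the product spaces $Y^{E(T)}$. The symmetric group permutes vertex labels. For $T_1\in\mathrm{NAP}_Y(n)$, $T_2\in\mathrm{NAP}_Y(m)$, $i\in[n]$, the composition $T_1\circ_iT_2\in\mathrm{NAP}_Y(n+m-1)$ is obtained by identifying the root of $T_2$ with the vertex $i$ of $T_1$, rooting the result at the root of $T_1$, keeping all edges and labels, and renumbering: vertices $l<i$ of $T_1$ keep their number, each vertex $l$ of $T_2$ (including its root, which is the merged vertex) becomes $l+i-1$, vertices $l>i$ of $T_1$ become $l+m-1$. This makes $\mathrm{NAP}_Y$ an operad. An edge $i\to j$ of a $Y$-tree $T$ is reducible if $i$ is not the root of $T$ and $i\to j$ is labelled by the basepoint $\bullet$. If $k\to i$ is the unique edge entering $i$, with label $y$, then the reduction $T_{ij}$ is the $Y$-tree obtained from $T$ by removing $i\to j$ and adding the edge $k\to j$ with label $y$. $\mathrm{BCact}_Y(n)$ is the quotient space of $\mathrm{NAP}_Y(n)$ by the equivalence relation $\sim$ generated by $T\sim T_{ij}$ for all $T$ and all reducible edges $i\to j$ of $T$.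
   Formalization: For arbitrary Y the compositions of BCact_Y need not be jointly continuous for the ordinary product topology; this is claimed only for Hausdorff Y. For all Y they are shown continuous for the quotient topology of NAP_Y(n)×NAP_Y(m), and the operad axioms hold. *)

theory Defs
  imports "HOL-Analysis.Analysis" "HOL-Combinatorics.Permutations"
begin

section \<open>Operads in sets and in topological spaces\<close>

text \<open>
  Symmetric operads are presented by partial compositions. Since an element need not determine its
  arity, the arities are passed explicitly: \<open>cmp P n m i x y\<close> is \<open>x \<circ>\<^sub>i y\<close> for \<open>x\<close> of
  arity \<open>n\<close> and \<open>y\<close> of arity \<open>m\<close>, and \<open>act P n s x\<close> is the action of the permutation \<open>s\<close> of
  \<open>{1..n}\<close>. The symmetric groups act on the left, as in ``replace the vertex label \<open>l\<close> by \<open>s l\<close>'';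
  the usual right action is that of the inverse.
\<close>

record 'p operad_data =
  arity :: "nat \<Rightarrow> 'p topology"
  act :: "nat \<Rightarrow> (nat \<Rightarrow> nat) \<Rightarrow> 'p \<Rightarrow> 'p"
  cmp :: "nat \<Rightarrow> nat \<Rightarrow> nat \<Rightarrow> 'p \<Rightarrow> 'p \<Rightarrow> 'p"
  unit :: 'p

abbreviation elems :: "'p operad_data \<Rightarrow> nat \<Rightarrow> 'p set" where
  "elems P n \<equiv> topspace (arity P n)"

text \<open>
  The permutation of \<open>{1..n+m-1}\<close> with \<open>(s x) \<circ>\<^sub>s\<^sub>i (t y) = perm_comp n m i s t (x \<circ>\<^sub>i y)\<close>: the
  inputs of \<open>y\<close> form the block \<open>{i..<i+m}\<close>, which is permuted by \<open>t\<close> and moved to the block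
  starting at \<open>s i\<close>, while the remaining inputs are those of \<open>x\<close> and are permuted by \<open>s\<close>.
\<close>

definition perm_comp ::
  "nat \<Rightarrow> nat \<Rightarrow> nat \<Rightarrow> (nat \<Rightarrow> nat) \<Rightarrow> (nat \<Rightarrow> nat) \<Rightarrow> nat \<Rightarrow> nat" where
  "perm_comp n m i s t k =
     (if k \<in> {i..<i+m} then t (k + 1 - i) + s i - 1
      else if k \<in> {1..n+m-1} then
        let l = (if k < i then k else k + 1 - m)
        in if s l < s i then s l else s l + m - 1
      else k)"

definition operad :: "'p operad_data \<Rightarrow> bool" where
  "operad P \<longleftrightarrow>
     (\<forall>n s x. s permutes {1..n} \<longrightarrow> x \<in> elems P n \<longrightarrow> act P n s x \<in> elems P n) \<and>
     (\<forall>n x. x \<in> elems P n \<longrightarrow> act P n id x = x) \<and>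
     (\<forall>n s t x. s permutes {1..n} \<longrightarrow> t permutes {1..n} \<longrightarrow> x \<in> elems P n \<longrightarrow>
        act P n (s \<circ> t) x = act P n s (act P n t x)) \<and>
     unit P \<in> elems P 1 \<and>
     (\<forall>n m i x y. i \<in> {1..n} \<longrightarrow> x \<in> elems P n \<longrightarrow> y \<in> elems P m \<longrightarrow>
        cmp P n m i x y \<in> elems P (n + m - 1)) \<and>
     (\<forall>n x. x \<in> elems P n \<longrightarrow> cmp P 1 n 1 (unit P) x = x) \<and>
     (\<forall>n i x. i \<in> {1..n} \<longrightarrow> x \<in> elems P n \<longrightarrow> cmp P n 1 i x (unit P) = x) \<and>
     (\<forall>n m l i j x y z. i \<in> {1..n} \<longrightarrow> j \<in> {1..m} \<longrightarrow>
        x \<in> elems P n \<longrightarrow> y \<in> elems P m \<longrightarrow> z \<in> elems P l \<longrightarrow>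
        cmp P (n + m - 1) l (i + j - 1) (cmp P n m i x y) z =
        cmp P n (m + l - 1) i x (cmp P m l j y z)) \<and>
     (\<forall>n m l i k x y z. i \<in> {1..n} \<longrightarrow> k \<in> {1..n} \<longrightarrow> i < k \<longrightarrow>
        x \<in> elems P n \<longrightarrow> y \<in> elems P m \<longrightarrow> z \<in> elems P l \<longrightarrow>
        cmp P (n + m - 1) l (k + m - 1) (cmp P n m i x y) z =
        cmp P (n + l - 1) m i (cmp P n l k x z) y) \<and>
     (\<forall>n m i s t x y. i \<in> {1..n} \<longrightarrow> s permutes {1..n} \<longrightarrow> t permutes {1..m} \<longrightarrow>
        x \<in> elems P n \<longrightarrow> y \<in> elems P m \<longrightarrow>
        cmp P n m (s i) (act P n s x) (act P m t y) =
        act P (n + m - 1) (perm_comp n m i s t) (cmp P n m i x y))"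

definition topological_operad :: "'p operad_data \<Rightarrow> bool" where
  "topological_operad P \<longleftrightarrow> operad P \<and>
     (\<forall>n s. s permutes {1..n} \<longrightarrow> continuous_map (arity P n) (arity P n) (act P n s)) \<and>
     (\<forall>n m i. i \<in> {1..n} \<longrightarrow>
        continuous_map (prod_topology (arity P n) (arity P m)) (arity P (n + m - 1))
          (\<lambda>(x, y). cmp P n m i x y))"

definition operad_morphism ::
  "'p operad_data \<Rightarrow> 'q operad_data \<Rightarrow> (nat \<Rightarrow> 'p \<Rightarrow> 'q) \<Rightarrow> bool" where
  "operad_morphism P Q f \<longleftrightarrow>
     (\<forall>n. f n \<in> elems P n \<rightarrow> elems Q n) \<and>
     f 1 (unit P) = unit Q \<and>
     (\<forall>n s x. s permutes {1..n} \<longrightarrow> x \<in> elems P n \<longrightarrow>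
        f n (act P n s x) = act Q n s (f n x)) \<and>
     (\<forall>n m i x y. i \<in> {1..n} \<longrightarrow> x \<in> elems P n \<longrightarrow> y \<in> elems P m \<longrightarrow>
        f (n + m - 1) (cmp P n m i x y) = cmp Q n m i (f n x) (f m y))"

text \<open>
  An operad ideal of an operad in sets (no linear structure) is a family of equivalence relations
  compatible with all structure maps.
\<close>

definition operad_ideal :: "'p operad_data \<Rightarrow> (nat \<Rightarrow> ('p \<times> 'p) set) \<Rightarrow> bool" where
  "operad_ideal P R \<longleftrightarrow>
     (\<forall>n. equiv (elems P n) (R n)) \<and>
     (\<forall>n s x x'. s permutes {1..n} \<longrightarrow> (x, x') \<in> R n \<longrightarrow> (act P n s x, act P n s x') \<in> R n) \<and>
     (\<forall>n m i x x' y y'. i \<in> {1..n} \<longrightarrow> (x, x') \<in> R n \<longrightarrow> (y, y') \<in> R m \<longrightarrow>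
        (cmp P n m i x y, cmp P n m i x' y') \<in> R (n + m - 1))"

definition generated_ideal ::
  "'p operad_data \<Rightarrow> (nat \<Rightarrow> ('p \<times> 'p) set) \<Rightarrow> nat \<Rightarrow> ('p \<times> 'p) set" where
  "generated_ideal P G n = \<Inter> {R n | R. operad_ideal P R \<and> (\<forall>k. G k \<subseteq> R k)}"

definition quotient_space :: "'a topology \<Rightarrow> ('a \<times> 'a) set \<Rightarrow> 'a set topology" where
  "quotient_space X R =
     topology (\<lambda>U. U \<subseteq> topspace X // R \<and> openin X {x \<in> topspace X. R `` {x} \<in> U})"

lemma openin_quotient_space:
  "openin (quotient_space X R) U \<longleftrightarrow>
     U \<subseteq> topspace X // R \<and> openin X {x \<in> topspace X. R `` {x} \<in> U}"
proof -
  have "istopology (\<lambda>U. U \<subseteq> topspace X // R \<and> openin X {x \<in> topspace X. R `` {x} \<in> U})"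
    unfolding istopology_def
  proof (intro conjI allI impI)
    fix S T
    assume "S \<subseteq> topspace X // R \<and> openin X {x \<in> topspace X. R `` {x} \<in> S}"
      and "T \<subseteq> topspace X // R \<and> openin X {x \<in> topspace X. R `` {x} \<in> T}"
    then have "openin X ({x \<in> topspace X. R `` {x} \<in> S} \<inter> {x \<in> topspace X. R `` {x} \<in> T})"
      by blast
    moreover have "{x \<in> topspace X. R `` {x} \<in> S} \<inter> {x \<in> topspace X. R `` {x} \<in> T} =
        {x \<in> topspace X. R `` {x} \<in> S \<inter> T}" by auto
    ultimately show "openin X {x \<in> topspace X. R `` {x} \<in> S \<inter> T}" by simp
  next
    fix K assume K: "\<forall>S\<in>K. S \<subseteq> topspace X // R \<and> openin X {x \<in> topspace X. R `` {x} \<in> S}"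
    have "{x \<in> topspace X. R `` {x} \<in> \<Union>K} = (\<Union>S\<in>K. {x \<in> topspace X. R `` {x} \<in> S})" by auto
    then show "openin X {x \<in> topspace X. R `` {x} \<in> \<Union>K}" using K by auto
  qed blast+
  then show ?thesis by (simp add: quotient_space_def)
qed

lemma topspace_quotient_space [simp]: "topspace (quotient_space X R) = topspace X // R"
proof -
  have "{x \<in> topspace X. R `` {x} \<in> topspace X // R} = topspace X"
    by (auto simp: quotient_def)
  then have "openin (quotient_space X R) (topspace X // R)"
    by (simp add: openin_quotient_space)
  then show ?thesis
    by (metis openin_quotient_space openin_subset openin_topspace subset_antisym)
qed

lemma quotient_map_quotient_space: "quotient_map X (quotient_space X R) (\<lambda>x. R `` {x})"
  by (auto simp: quotient_map_def openin_quotient_space quotient_def)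

text \<open>
  The structure maps of the quotient apply the structure maps of \<open>P\<close> to all representatives and
  saturate the result; for an operad ideal \<open>R\<close> this is the class obtained from any choice of
  representatives. Caution: for the ordinary product topology the composition of a quotient of a
  topological operad need not be jointly continuous, since a product of two quotient maps need not
  be a quotient map; it is continuous for the quotient topology of the product.
\<close>

definition quotient_operad ::
  "'p operad_data \<Rightarrow> (nat \<Rightarrow> ('p \<times> 'p) set) \<Rightarrow> 'p set operad_data" where
  "quotient_operad P R =
     \<lparr> arity = (\<lambda>n. quotient_space (arity P n) (R n)),
       act = (\<lambda>n s A. R n `` (act P n s ` A)),
       cmp = (\<lambda>n m i A B. R (n + m - 1) `` {cmp P n m i x y | x y. x \<in> A \<and> y \<in> B}),
       unit = R 1 `` {unit P} \<rparr>"


section \<open>The operad of Y-trees\<close>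

text \<open>A rooted tree is given by its root and its set of edges, oriented away from the root.\<close>

type_synonym rtree = "nat \<times> (nat \<times> nat) set"

definition rooted_tree :: "nat set \<Rightarrow> rtree \<Rightarrow> bool" where
  "rooted_tree V T \<longleftrightarrow> (case T of (r, E) \<Rightarrow>
     r \<in> V \<and> E \<subseteq> V \<times> V \<and>
     (\<forall>i. (i, r) \<notin> E) \<and>
     (\<forall>i i' j. (i, j) \<in> E \<longrightarrow> (i', j) \<in> E \<longrightarrow> i = i') \<and>
     (\<forall>j\<in>V. (r, j) \<in> E\<^sup>*))"

text \<open>
  The label of the edge \<open>i \<rightarrow> j\<close> of \<open>(T, f)\<close> is \<open>f (i, j)\<close>; the function \<open>f\<close> is \<open>undefined\<close>
  outside the edge set, as required of a point of the product over the edges.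
\<close>

type_synonym 'y ytree = "rtree \<times> (nat \<times> nat \<Rightarrow> 'y)"

definition nap_space :: "nat \<Rightarrow> ('y::topological_space) ytree topology" where
  "nap_space n =
     sum_topology (\<lambda>(r, E). product_topology (\<lambda>_. euclidean) E) {T. rooted_tree {1..n} T}"

definition push_labels ::
  "(nat \<Rightarrow> nat) \<Rightarrow> (nat \<times> nat) set \<Rightarrow> (nat \<times> nat \<Rightarrow> 'y) \<Rightarrow> nat \<times> nat \<Rightarrow> 'y" where
  "push_labels g E f = (\<lambda>e\<in>map_prod g g ` E. f (the_inv_into E (map_prod g g) e))"

definition relabel :: "(nat \<Rightarrow> nat) \<Rightarrow> 'y ytree \<Rightarrow> 'y ytree" where
  "relabel s T = (case T of ((r, E), f) \<Rightarrow> ((s r, map_prod s s ` E), push_labels s E f))"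

text \<open>
  Renumbering of the vertices of \<open>T\<^sub>1\<close> in \<open>T\<^sub>1 \<circ>\<^sub>i T\<^sub>2\<close>, where \<open>m\<close> is the arity and \<open>r\<close> the root
  of \<open>T\<^sub>2\<close>; the vertex \<open>i\<close> becomes the renumbered root of \<open>T\<^sub>2\<close>.
\<close>

definition outer_num :: "nat \<Rightarrow> nat \<Rightarrow> nat \<Rightarrow> nat \<Rightarrow> nat" where
  "outer_num m i r l = (if l < i then l else if l = i then r + i - 1 else l + m - 1)"

definition inner_num :: "nat \<Rightarrow> nat \<Rightarrow> nat" where
  "inner_num i l = l + i - 1"

definition graft :: "nat \<Rightarrow> nat \<Rightarrow> 'y ytree \<Rightarrow> 'y ytree \<Rightarrow> 'y ytree" where
  "graft m i T1 T2 = (case (T1, T2) of (((r1, E1), f1), ((r2, E2), f2)) \<Rightarrow>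
     let g = outer_num m i r2; h = inner_num i;
         E1' = map_prod g g ` E1; E2' = map_prod h h ` E2
     in ((g r1, E1' \<union> E2'),
         (\<lambda>e. if e \<in> E1' then push_labels g E1 f1 e else push_labels h E2 f2 e)))"

definition NAP :: "('y::topological_space) ytree operad_data" where
  "NAP = \<lparr> arity = nap_space,
           act = (\<lambda>n. relabel),
           cmp = (\<lambda>n. graft),
           unit = ((1, {}), \<lambda>_. undefined) \<rparr>"


section \<open>Reductions and the quotient\<close>

definition reducible :: "'y \<Rightarrow> 'y ytree \<Rightarrow> nat \<Rightarrow> nat \<Rightarrow> bool" where
  "reducible b T i j \<longleftrightarrow> (case T of ((r, E), f) \<Rightarrow> (i, j) \<in> E \<and> i \<noteq> r \<and> f (i, j) = b)"

definition reduct :: "'y ytree \<Rightarrow> nat \<Rightarrow> nat \<Rightarrow> 'y ytree" where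
  "reduct T i j = (case T of ((r, E), f) \<Rightarrow>
     let k = (THE k. (k, i) \<in> E); E' = insert (k, j) (E - {(i, j)})
     in ((r, E'), restrict (f((k, j) := f (k, i))) E'))"

definition red_step :: "'y::topological_space \<Rightarrow> nat \<Rightarrow> 'y ytree \<Rightarrow> 'y ytree \<Rightarrow> bool" where
  "red_step b n T T' \<longleftrightarrow> T \<in> elems NAP n \<and> (\<exists>i j. reducible b T i j \<and> T' = reduct T i j)"

definition red_equiv :: "'y::topological_space \<Rightarrow> nat \<Rightarrow> ('y ytree \<times> 'y ytree) set" where
  "red_equiv b n = {(T, T'). T \<in> elems NAP n \<and> T' \<in> elems NAP n \<and> equivclp (red_step b n) T T'}"

definition BCact :: "'y::topological_space \<Rightarrow> 'y ytree set operad_data" where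
  "BCact b = quotient_operad NAP (red_equiv b)"

abbreviation BCact_proj :: "'y::topological_space \<Rightarrow> nat \<Rightarrow> 'y ytree \<Rightarrow> 'y ytree set" where
  "BCact_proj b n T \<equiv> red_equiv b n `` {T}"

definition chain3 :: "'y \<Rightarrow> 'y \<Rightarrow> 'y ytree" where
  "chain3 y z = ((1, {(1, 2), (2, 3)}), (\<lambda>e\<in>{(1, 2), (2, 3)}. if e = (1, 2) then y else z))"

definition cherry3 :: "'y \<Rightarrow> 'y \<Rightarrow> 'y ytree" where
  "cherry3 y z = ((1, {(1, 2), (1, 3)}), (\<lambda>e\<in>{(1, 2), (1, 3)}. if e = (1, 2) then y else z))"

definition basic_relation :: "'y \<Rightarrow> nat \<Rightarrow> ('y ytree \<times> 'y ytree) set" where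
  "basic_relation b n = (if n = 3 then {(chain3 y b, cherry3 y y) | y. True} else {})"

end

theory Submission
  imports Defs
begin

text \<open>
  A Y-tree is determined by its root and the graph of its labelling, that is, its set of
  labelled edges. In this description relabelling vertices is taking an image, grafting is
  taking a union after renumbering, and a reduction replaces the labelled edge \<open>(i \<rightarrow> j, b)\<close> by
  \<open>(k \<rightarrow> j, y)\<close>, where \<open>(k \<rightarrow> i, y)\<close> is the edge entering \<open>i\<close>. The operad axioms for \<open>NAP\<close> become
  identities between renumberings of vertices, and a reduction of one part of a tree is visibly
  a reduction of every relabelling of it and of every tree in which it is grafted
  (\<open>reduces_relabel\<close>, \<open>reduces_glue_left\<close>, \<open>reduces_glue_right\<close>), because the edge entering \<open>i\<close>
  still enters \<open>i\<close> there. Hence the generated equivalence relation is an operad ideal, and the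
  quotient of an operad by an ideal is an operad.

  For generation by the relation in arity \<open>3\<close>, let \<open>i \<rightarrow> j\<close> be reducible, with \<open>k \<rightarrow> i\<close>. Cutting
  \<open>T\<close> at the descendants of \<open>i\<close> and at those of \<open>j\<close> leaves the part \<open>A\<close> around \<open>k\<close>, the part \<open>B\<close>
  hanging from \<open>i\<close> and the part \<open>C\<close> hanging from \<open>j\<close>, so \<open>T\<close> is the chain \<open>k \<rightarrow> i \<rightarrow> j\<close> with \<open>B\<close>
  and \<open>C\<close> grafted at \<open>i\<close> and \<open>j\<close>, and the result grafted at the vertex \<open>k\<close> of \<open>A\<close>; the reduction
  is the same composite with a cherry instead of the chain (\<open>reduces_imp_ideal_on\<close>). Grafts
  along arbitrary finite vertex sets are numbered grafts up to relabelling
  (\<open>glue_relabels_to_graft\<close>), so an ideal containing the basic relation contains the reduction.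

  Joint continuity of the composition of the quotient for Hausdorff \<open>Y\<close> needs the product of two
  projections to be a quotient map. It is one because the projections are proper. Reductions
  introduce no labels and remove at most the label \<open>b\<close>, so a class lives on the finitely many
  trees with labels among those of one member and \<open>b\<close>; the classes are finite, of size bounded
  in terms of the arity, and equivalent trees are joined by a number of steps that is bounded as
  well (\<open>red_equiv_class_bounded\<close>). A single step in either direction sends closed sets to
  closed sets, since a reduction identifies the closed set \<open>f (i, j) = b\<close> of labellings with the
  closed set \<open>f (k, j) = f (k, i)\<close>; both are closed because \<open>Y\<close> is Hausdorff. So saturations of
  closed sets are finite unions of closed sets (\<open>closedin_red_equiv_saturation\<close>).
\<close>

section \<open>Rooted trees\<close>

text \<open>
  Parents are unique, so a cycle through \<open>w\<close> passes through the parent of \<open>w\<close>, and going up it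
  would pass through the root, which has no incoming edge.
\<close>

lemma no_cycle_in_rooted_tree:
  assumes "rooted_tree V (r, E)" "x \<in> V"
  shows "(x, x) \<notin> E\<^sup>+"
proof -
  have "(r, x) \<in> E\<^sup>*" and into_root: "\<And>i. (i, r) \<notin> E"
    and parent: "\<And>i i' j. (i, j) \<in> E \<Longrightarrow> (i', j) \<in> E \<Longrightarrow> i = i'"
    using assms by (auto simp: rooted_tree_def)
  then show ?thesis
  proof (induction rule: rtrancl_induct)
    case base
    show ?case using into_root by (metis tranclD2)
  next
    case (step u w)
    show ?case
    proof
      assume "(w, w) \<in> E\<^sup>+"
      then obtain u' where "(w, u') \<in> E\<^sup>*" "(u', w) \<in> E" by (meson tranclD2)
      then have "(u, u) \<in> E\<^sup>+" using parent step.hyps(2) by (metis rtrancl_into_trancl2)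
      then show False using step.IH parent into_root by blast
    qed
  qed
qed

lemma rooted_tree_image:
  assumes T: "rooted_tree V (r, E)" and inj: "inj_on s V"
  shows "rooted_tree (s ` V) (s r, map_prod s s ` E)"
proof -
  have r: "r \<in> V" and E: "E \<subseteq> V \<times> V" and into_root: "\<And>i. (i, r) \<notin> E"
    and parent: "\<And>i i' j. (i, j) \<in> E \<Longrightarrow> (i', j) \<in> E \<Longrightarrow> i = i'"
    and reach: "\<And>j. j \<in> V \<Longrightarrow> (r, j) \<in> E\<^sup>*"
    using T by (auto simp: rooted_tree_def)
  have path: "(s x, s y) \<in> (map_prod s s ` E)\<^sup>*" if "(x, y) \<in> E\<^sup>*" for x y
    using that
  proof (induction rule: rtrancl_induct)
    case (step u w)
    then have "(s u, s w) \<in> map_prod s s ` E" by (force simp: image_iff)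
    with step.IH show ?case by (rule rtrancl_into_rtrancl)
  qed simp
  have "(i, s r) \<notin> map_prod s s ` E" for i
    using into_root inj_onD[OF inj] r E by fastforce
  moreover have "i = i'" if "(i, j) \<in> map_prod s s ` E" "(i', j) \<in> map_prod s s ` E" for i i' j
    using that parent inj_onD[OF inj] E by (auto simp: subset_iff) metis
  ultimately show ?thesis
    using r E path reach unfolding rooted_tree_def by auto
qed

lemma rooted_tree_union:
  assumes T: "rooted_tree V (r, E)" and T': "rooted_tree V' (r', E')" and meet: "V \<inter> V' = {r'}"
  shows "rooted_tree (V \<union> V') (r, E \<union> E')"
proof -
  have r: "r \<in> V" and E: "E \<subseteq> V \<times> V" and into_root: "\<And>i. (i, r) \<notin> E"
    and parent: "\<And>i i' j. (i, j) \<in> E \<Longrightarrow> (i', j) \<in> E \<Longrightarrow> i = i'"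
    and reach: "\<And>j. j \<in> V \<Longrightarrow> (r, j) \<in> E\<^sup>*"
    using T by (auto simp: rooted_tree_def)
  have E': "E' \<subseteq> V' \<times> V'" and into_root': "\<And>i. (i, r') \<notin> E'"
    and parent': "\<And>i i' j. (i, j) \<in> E' \<Longrightarrow> (i', j) \<in> E' \<Longrightarrow> i = i'"
    and reach': "\<And>j. j \<in> V' \<Longrightarrow> (r', j) \<in> E'\<^sup>*"
    using T' by (auto simp: rooted_tree_def)
  have head: "j \<notin> V" if "(i, j) \<in> E'" for i j
  proof
    assume "j \<in> V"
    then have "j = r'" using that E' meet by auto
    then show False using that into_root' by simp
  qed
  have "(r, j) \<in> (E \<union> E')\<^sup>*" if "j \<in> V \<union> V'" for j
  proof (cases "j \<in> V")
    case True
    then show ?thesis using reach rtrancl_mono[of E "E \<union> E'"] by blast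
  next
    case False
    then have "(r', j) \<in> (E \<union> E')\<^sup>*" using that reach' rtrancl_mono[of E' "E \<union> E'"] by blast
    moreover have "(r, r') \<in> (E \<union> E')\<^sup>*"
      using meet reach rtrancl_mono[of E "E \<union> E'"] by blast
    ultimately show ?thesis by (metis rtrancl_trans)
  qed
  moreover have "i = i'" if "(i, j) \<in> E \<union> E'" "(i', j) \<in> E \<union> E'" for i i' j
    using that parent parent' head E by blast
  moreover have "(i, r) \<notin> E \<union> E'" for i
    using into_root head r by blast
  ultimately show ?thesis
    using r E E' unfolding rooted_tree_def by auto
qed

text \<open>
  The only edge that a path from the root loses in a reduction is \<open>i \<rightarrow> j\<close>; such a path enters
  \<open>i\<close> through its unique parent \<open>k\<close> and is redirected along \<open>k \<rightarrow> j\<close>.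
\<close>

lemma rooted_tree_move_up:
  assumes T: "rooted_tree V (r, E)" and ki: "(k, i) \<in> E" and ij: "(i, j) \<in> E"
  shows "rooted_tree V (r, insert (k, j) (E - {(i, j)}))"
proof (cases "i = j")
  case True
  \<comment> \<open>A loop at \<open>i\<close> forces \<open>k = i\<close>, and then nothing is moved.\<close>
  with T ki ij have "insert (k, j) (E - {(i, j)}) = E" by (auto simp: rooted_tree_def)
  with T show ?thesis by simp
next
  case False
  let ?E = "insert (k, j) (E - {(i, j)})"
  have r: "r \<in> V" and E: "E \<subseteq> V \<times> V" and into_root: "\<And>i. (i, r) \<notin> E"
    and parent: "\<And>i i' j. (i, j) \<in> E \<Longrightarrow> (i', j) \<in> E \<Longrightarrow> i = i'"
    and reach: "\<And>j. j \<in> V \<Longrightarrow> (r, j) \<in> E\<^sup>*"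
    using T by (auto simp: rooted_tree_def)
  have "(r, v) \<in> ?E\<^sup>*" if "(r, v) \<in> E\<^sup>*" for v
    using that
  proof (induction rule: rtrancl_induct)
    case (step u w)
    show ?case
    proof (cases "(u, w) = (i, j)")
      case True
      then have "(r, i) \<in> ?E\<^sup>*" "i \<noteq> r" using step.IH into_root ki by auto
      then obtain k' where k': "(r, k') \<in> ?E\<^sup>*" "(k', i) \<in> ?E" by (metis rtranclE)
      then have "k' = k" using False parent ki by blast
      then have "(r, j) \<in> ?E\<^sup>*" using k'(1) by (meson insertI1 rtrancl_into_rtrancl)
      with True show ?thesis by simp
    next
      case False
      then show ?thesis using step by (meson DiffI insertCI rtrancl_into_rtrancl singletonD)
    qed
  qed simp
  with r E into_root parent reach ki ij show ?thesis
    unfolding rooted_tree_def by (auto dest: parent)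
qed

text \<open>
  This lemma and the next one cut a tree at the edge entering \<open>i\<close> into the tree of descendants
  of \<open>i\<close> and the tree of the other vertices.
\<close>

lemma rooted_tree_descendants:
  assumes T: "rooted_tree V (r, E)" and i: "i \<in> V"
  defines "D \<equiv> E\<^sup>* `` {i}"
  shows "rooted_tree D (i, E \<inter> D \<times> D)"
proof -
  have "(i, j) \<in> (E \<inter> D \<times> D)\<^sup>*" if "(i, j) \<in> E\<^sup>*" for j
    using that
  proof (induction rule: rtrancl_induct)
    case (step u w)
    then have "(u, w) \<in> E \<inter> D \<times> D" unfolding D_def by (auto intro: rtrancl_into_rtrancl)
    with step.IH show ?case by (rule rtrancl_into_rtrancl)
  qed simp
  moreover have "(x, i) \<notin> E \<inter> D \<times> D" for x
    using no_cycle_in_rooted_tree[OF T i] unfolding D_def by (auto intro: rtrancl_into_trancl1)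
  ultimately show ?thesis
    using T unfolding rooted_tree_def D_def by auto
qed

lemma rooted_tree_nondescendants:
  assumes T: "rooted_tree V (r, E)" and ki: "(k, i) \<in> E"
  defines "D \<equiv> E\<^sup>* `` {i}"
  shows "rooted_tree (V - D) (r, E \<inter> (V - D) \<times> (V - D))" and "k \<in> V - D" and "D \<subseteq> V"
    and "E = E \<inter> (V - D) \<times> (V - D) \<union> {(k, i)} \<union> E \<inter> D \<times> D"
proof -
  have r: "r \<in> V" and E: "E \<subseteq> V \<times> V" and into_root: "\<And>i. (i, r) \<notin> E"
    and parent: "\<And>i i' j. (i, j) \<in> E \<Longrightarrow> (i', j) \<in> E \<Longrightarrow> i = i'"
    and reach: "\<And>j. j \<in> V \<Longrightarrow> (r, j) \<in> E\<^sup>*"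
    using T by (auto simp: rooted_tree_def)
  have D_step: "w \<in> D" if "u \<in> D" "(u, w) \<in> E" for u w
    using that unfolding D_def by (auto intro: rtrancl_into_rtrancl)
  show k: "k \<in> V - D"
    using no_cycle_in_rooted_tree[OF T, of k] ki E unfolding D_def
    by (auto intro: rtrancl_into_trancl2)
  have "v \<in> V" if "(i, v) \<in> E\<^sup>*" for v
    using that E ki by (auto elim: rtranclE)
  then show "D \<subseteq> V" unfolding D_def by auto
  have head: "u = k \<and> w = i" if "(u, w) \<in> E" "w \<in> D" "u \<notin> D" for u w
  proof -
    have "(i, w) \<in> E\<^sup>*" using that unfolding D_def by auto
    then have "w = i"
    proof (cases rule: rtranclE)
      case (step u')
      then show ?thesis using that parent unfolding D_def by blast
    qed simp
    with that parent ki show ?thesis by blast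
  qed
  show "E = E \<inter> (V - D) \<times> (V - D) \<union> {(k, i)} \<union> E \<inter> D \<times> D"
  proof (intro equalityI subrelI)
    fix u w assume "(u, w) \<in> E"
    then show "(u, w) \<in> E \<inter> (V - D) \<times> (V - D) \<union> {(k, i)} \<union> E \<inter> D \<times> D"
      using head[of u w] D_step[of u w] E by auto
  qed (use ki in auto)
  have rD: "r \<notin> D"
  proof
    assume "r \<in> D"
    then have "(i, r) \<in> E\<^sup>*" unfolding D_def by auto
    then have "i = r" using into_root by (auto elim: rtranclE)
    then show False using into_root ki by blast
  qed
  have "(r, j) \<in> (E \<inter> (V - D) \<times> (V - D))\<^sup>*" if "(r, j) \<in> E\<^sup>*" "j \<notin> D" for j
    using that
  proof (induction rule: rtrancl_induct)
    case (step u w)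
    then have "u \<notin> D" using D_step by blast
    then have "(u, w) \<in> E \<inter> (V - D) \<times> (V - D)" using step.hyps step.prems E by auto
    then show ?case using step.IH[OF \<open>u \<notin> D\<close>] by (rule rtrancl_into_rtrancl[rotated])
  qed simp
  then show "rooted_tree (V - D) (r, E \<inter> (V - D) \<times> (V - D))"
    using r rD into_root parent reach unfolding rooted_tree_def by (auto dest: parent)
qed

section \<open>Y-trees and their labelled edges\<close>

definition ytree_on :: "nat set \<Rightarrow> 'y ytree \<Rightarrow> bool" where
  "ytree_on V T \<longleftrightarrow> rooted_tree V (fst T) \<and> snd T \<in> extensional (snd (fst T))"

definition root_of :: "'y ytree \<Rightarrow> nat" where
  "root_of T = fst (fst T)"

text \<open>
  The graph of the labelling. Together with the root it determines the tree, and unlike a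
  function that is \<open>undefined\<close> outside an edge set it can be relabelled and glued by plain
  images and unions.
\<close>

definition labelled_edges :: "'y ytree \<Rightarrow> ((nat \<times> nat) \<times> 'y) set" where
  "labelled_edges T = (\<lambda>e. (e, snd T e)) ` snd (fst T)"

definition move_edges ::
  "(nat \<Rightarrow> nat) \<Rightarrow> ((nat \<times> nat) \<times> 'y) set \<Rightarrow> ((nat \<times> nat) \<times> 'y) set" where
  "move_edges s L = map_prod (map_prod s s) id ` L"

text \<open>
  The union of two trees that share exactly one vertex, the root of the second; this is the
  composition of the operad without renumbering.
\<close>

definition glue :: "'y ytree \<Rightarrow> 'y ytree \<Rightarrow> 'y ytree" where
  "glue S T = ((root_of S, snd (fst S) \<union> snd (fst T)),
     (\<lambda>e. if e \<in> snd (fst S) then snd S e else snd T e))"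

lemma elems_NAP: "elems NAP n = {T. ytree_on {1..n} T}"
  by (auto simp: NAP_def nap_space_def ytree_on_def PiE_UNIV_domain PiE_def)

lemma edges_eq: "snd (fst T) = fst ` labelled_edges T"
  by (force simp: labelled_edges_def)

lemma ytree_eqI:
  assumes "ytree_on V S" "ytree_on V' T" "root_of S = root_of T" "labelled_edges S = labelled_edges T"
  shows "S = T"
proof -
  have E: "snd (fst S) = snd (fst T)" using assms(4) by (simp add: edges_eq)
  have "snd S e = snd T e" for e
  proof (cases "e \<in> snd (fst S)")
    case True
    then have "(e, snd S e) \<in> labelled_edges T"
      using assms(4) unfolding labelled_edges_def by auto
    then show ?thesis unfolding labelled_edges_def by auto
  next
    case False
    then show ?thesis using assms(1,2) E by (cases e) (simp add: ytree_on_def extensional_def)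
  qed
  with E assms(3) show ?thesis by (auto simp: root_of_def prod_eq_iff)
qed

lemma labelled_edge_vertices:
  "ytree_on V T \<Longrightarrow> ((i, j), y) \<in> labelled_edges T \<Longrightarrow> i \<in> V \<and> j \<in> V"
  by (auto simp: ytree_on_def rooted_tree_def labelled_edges_def)

lemma root_of_in: "ytree_on V T \<Longrightarrow> root_of T \<in> V"
  by (auto simp: ytree_on_def rooted_tree_def root_of_def)

lemma root_of_relabel [simp]: "root_of (relabel s T) = s (root_of T)"
  by (simp add: relabel_def root_of_def split: prod.splits)

lemma edges_relabel: "snd (fst (relabel s T)) = map_prod s s ` snd (fst T)"
  by (simp add: relabel_def split: prod.splits)

lemma inj_on_edges:
  assumes "inj_on s V" "E \<subseteq> V \<times> V"
  shows "inj_on (map_prod s s) E"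
  using map_prod_inj_on[OF assms(1,1)] assms(2) by (rule inj_on_subset)

lemma relabel_ytree:
  assumes T: "ytree_on V T" and inj: "inj_on s V"
  shows "ytree_on (s ` V) (relabel s T)"
    and "labelled_edges (relabel s T) = move_edges s (labelled_edges T)"
proof -
  obtain r E f where [simp]: "T = ((r, E), f)" by (metis surj_pair)
  have E: "E \<subseteq> V \<times> V" using T by (auto simp: ytree_on_def rooted_tree_def)
  then have inj': "inj_on (map_prod s s) E" using inj_on_edges[OF inj] by blast
  show "ytree_on (s ` V) (relabel s T)"
    using T rooted_tree_image[OF _ inj]
    by (auto simp: ytree_on_def relabel_def push_labels_def)
  show "labelled_edges (relabel s T) = move_edges s (labelled_edges T)"
    unfolding labelled_edges_def move_edges_def edges_relabel image_image
  proof (intro image_cong)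
    fix e assume "e \<in> snd (fst T)"
    then show "(map_prod s s e, snd (relabel s T) (map_prod s s e)) =
        map_prod (map_prod s s) id (e, snd T e)"
      by (simp add: relabel_def push_labels_def the_inv_into_f_f[OF inj'])
  qed simp
qed

lemma root_of_glue [simp]: "root_of (glue S T) = root_of S"
  by (simp add: glue_def root_of_def)

lemma glue_ytree:
  assumes S: "ytree_on V S" and T: "ytree_on V' T" and meet: "V \<inter> V' = {root_of T}"
  shows "ytree_on (V \<union> V') (glue S T)"
    and "labelled_edges (glue S T) = labelled_edges S \<union> labelled_edges T"
    and "snd (fst S) \<inter> snd (fst T) = {}"
proof -
  show disj: "snd (fst S) \<inter> snd (fst T) = {}"
  proof (rule ccontr)
    assume "snd (fst S) \<inter> snd (fst T) \<noteq> {}"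
    then obtain x y where xy: "(x, y) \<in> snd (fst S)" "(x, y) \<in> snd (fst T)" by auto
    then have "y \<in> V \<inter> V'" using S T by (auto simp: ytree_on_def rooted_tree_def)
    then have "y = root_of T" using meet by blast
    then show False using T xy by (auto simp: ytree_on_def rooted_tree_def root_of_def)
  qed
  show "ytree_on (V \<union> V') (glue S T)"
    using S T rooted_tree_union[of V "fst (fst S)" "snd (fst S)" V' "fst (fst T)" "snd (fst T)"] meet
    by (auto simp: ytree_on_def glue_def extensional_def root_of_def)
  show "labelled_edges (glue S T) = labelled_edges S \<union> labelled_edges T"
    using disj by (auto simp: glue_def labelled_edges_def image_iff)
qed

lemma graft_eq_glue:
  "graft m i S T = glue (relabel (outer_num m i (root_of T)) S) (relabel (inner_num i) T)"
  by (auto simp: graft_def glue_def relabel_def root_of_def Let_def split: prod.splits)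

lemma relabel_cong:
  assumes T: "ytree_on V T" and eq: "\<And>v. v \<in> V \<Longrightarrow> s v = t v" and inj: "inj_on s V"
  shows "relabel s T = relabel t T"
proof (rule ytree_eqI)
  have inj': "inj_on t V" using inj eq by (simp cong: inj_on_cong)
  show "ytree_on (s ` V) (relabel s T)" "ytree_on (t ` V) (relabel t T)"
    using relabel_ytree T inj inj' by blast+
  show "root_of (relabel s T) = root_of (relabel t T)" using eq root_of_in[OF T] by simp
  have "move_edges s (labelled_edges T) = move_edges t (labelled_edges T)"
    unfolding move_edges_def
    using eq labelled_edge_vertices[OF T] by (intro image_cong) auto
  then show "labelled_edges (relabel s T) = labelled_edges (relabel t T)"
    using relabel_ytree(2) T inj inj' by metis
qed

lemma move_edges_comp: "move_edges s (move_edges t L) = move_edges (s \<circ> t) L"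
  by (auto simp: move_edges_def image_image intro!: image_cong)

lemma move_edges_Un: "move_edges s (L \<union> M) = move_edges s L \<union> move_edges s M"
  by (simp add: move_edges_def image_Un)

lemma relabel_relabel:
  assumes T: "ytree_on V T" and t: "inj_on t V" and s: "inj_on s (t ` V)"
  shows "relabel s (relabel t T) = relabel (s \<circ> t) T"
proof (rule ytree_eqI)
  note rT = relabel_ytree[OF T t]
  have st: "inj_on (s \<circ> t) V" using s t comp_inj_on by blast
  show "ytree_on (s ` t ` V) (relabel s (relabel t T))" "ytree_on ((s \<circ> t) ` V) (relabel (s \<circ> t) T)"
    using relabel_ytree rT(1) s T st by blast+
  show "labelled_edges (relabel s (relabel t T)) = labelled_edges (relabel (s \<circ> t) T)"
    using relabel_ytree(2)[OF rT(1) s] rT(2) relabel_ytree(2)[OF T st] move_edges_comp by metis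
qed simp

lemma relabel_id:
  assumes T: "ytree_on V T"
  shows "relabel id T = T"
proof (rule ytree_eqI[OF _ T])
  show "ytree_on (id ` V) (relabel id T)" "labelled_edges (relabel id T) = labelled_edges T"
    using relabel_ytree[OF T, of id] by (simp_all add: move_edges_def map_prod.id)
qed simp

lemma relabel_glue:
  assumes S: "ytree_on V S" and T: "ytree_on V' T" and meet: "V \<inter> V' = {root_of T}"
    and inj: "inj_on s (V \<union> V')"
  shows "relabel s (glue S T) = glue (relabel s S) (relabel s T)"
    and "s ` V \<inter> s ` V' = {s (root_of T)}"
proof -
  have inj': "inj_on s V" "inj_on s V'" using inj inj_on_subset by blast+
  show meet': "s ` V \<inter> s ` V' = {s (root_of T)}"
    using inj_on_image_Int[OF inj, of V V'] meet by simp
  note gl = glue_ytree[OF S T meet]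
  note rS = relabel_ytree[OF S inj'(1)] and rT = relabel_ytree[OF T inj'(2)]
  have "s ` V \<inter> s ` V' = {root_of (relabel s T)}" using meet' by simp
  note gl' = glue_ytree[OF rS(1) rT(1) this]
  show "relabel s (glue S T) = glue (relabel s S) (relabel s T)"
  proof (rule ytree_eqI[OF relabel_ytree(1)[OF gl(1) inj] gl'(1)])
    show "labelled_edges (relabel s (glue S T)) = labelled_edges (glue (relabel s S) (relabel s T))"
      by (simp add: relabel_ytree(2)[OF gl(1) inj] gl(2) gl'(2) rS rT move_edges_Un)
  qed simp
qed

section \<open>The operad of Y-trees\<close>

text \<open>
  The root \<open>r\<close> of the inner tree matters for the vertex \<open>i\<close> only. With \<open>i\<close> left out, \<open>r\<close> is
  arbitrary and \<open>m = 0\<close> is covered; this is needed for quotients of operads with elements of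
  arity \<open>0\<close>.
\<close>

lemma numbering_cover:
  assumes i: "i \<in> {1..n}"
  shows "outer_num m i r ` ({1..n} - {i}) \<union> inner_num i ` {1..m} = {1..n + m - 1}"
proof
  show "outer_num m i r ` ({1..n} - {i}) \<union> inner_num i ` {1..m} \<subseteq> {1..n + m - 1}"
    using assms by (auto simp: outer_num_def inner_num_def)
  show "{1..n + m - 1} \<subseteq> outer_num m i r ` ({1..n} - {i}) \<union> inner_num i ` {1..m}"
  proof
    fix k assume k: "k \<in> {1..n + m - 1}"
    consider "k < i" | "i \<le> k" "k < i + m" | "i + m \<le> k" by linarith
    then show "k \<in> outer_num m i r ` ({1..n} - {i}) \<union> inner_num i ` {1..m}"
    proof cases
      case 1
      then have "k = outer_num m i r k" "k \<in> {1..n} - {i}" using k i by (auto simp: outer_num_def)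
      then show ?thesis by blast
    next
      case 2
      then have "k = inner_num i (k + 1 - i)" "k + 1 - i \<in> {1..m}"
        using i by (auto simp: inner_num_def)
      then show ?thesis by blast
    next
      case 3
      then have "k = outer_num m i r (k + 1 - m)" "k + 1 - m \<in> {1..n} - {i}"
        using i k by (auto simp: outer_num_def)
      then show ?thesis by blast
    qed
  qed
qed

lemma outer_num_root: "outer_num m i r i = inner_num i r"
  by (simp add: outer_num_def inner_num_def)

text \<open>
  These are the conditions for gluing the renumbered trees: renumbering is injective on both,
  and only the merged vertex is shared.
\<close>

lemma numbering:
  assumes i: "i \<in> {1..n}" and r: "r \<in> {1..m}"
  shows "inj_on (outer_num m i r) {1..n}" and "inj_on (inner_num i) {1..m}"
    and "outer_num m i r ` {1..n} \<inter> inner_num i ` {1..m} = {inner_num i r}"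
    and "outer_num m i r ` {1..n} \<union> inner_num i ` {1..m} = {1..n + m - 1}"
proof -
  obtain i' r' where Suc: "i = Suc i'" "r = Suc r'" and r': "r' < m"
    using i r by (cases i; cases r) auto
  show "inj_on (outer_num m i r) {1..n}"
  proof (rule inj_onI)
    fix v w assume "outer_num m i r v = outer_num m i r w"
    then show "v = w" using r' unfolding outer_num_def Suc
      by (cases v "Suc i'" rule: linorder_cases; cases w "Suc i'" rule: linorder_cases) auto
  qed
  show "inj_on (inner_num i) {1..m}"
    by (auto simp: inj_on_def inner_num_def Suc)
  have "v = i" if "w \<in> {1..m}" "outer_num m i r v = inner_num i w" for v w
    using that r' unfolding outer_num_def inner_num_def Suc
    by (cases v "Suc i'" rule: linorder_cases) auto
  then show "outer_num m i r ` {1..n} \<inter> inner_num i ` {1..m} = {inner_num i r}"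
    using assms outer_num_root[of m i r] by force
  have "{1..n} = insert i ({1..n} - {i})" using i by auto
  then have "outer_num m i r ` {1..n} = insert (inner_num i r) (outer_num m i r ` ({1..n} - {i}))"
    using outer_num_root[of m i r] by (metis image_insert)
  then show "outer_num m i r ` {1..n} \<union> inner_num i ` {1..m} = {1..n + m - 1}"
    using numbering_cover[OF i, of m r] r by auto
qed

lemma labelled_edges_trivial [simp]: "labelled_edges ((r, {}), f) = {}"
  by (simp add: labelled_edges_def)

lemma root_of_simp [simp]: "root_of ((r, E), f) = r"
  by (simp add: root_of_def)

lemma move_edges_empty [simp]: "move_edges s {} = {}"
  by (simp add: move_edges_def)

lemma graft_ytree:
  assumes i: "i \<in> {1..n}" and S: "ytree_on {1..n} S" and T: "ytree_on {1..m} T"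
  shows "ytree_on {1..n + m - 1} (graft m i S T)"
    and "root_of (graft m i S T) = outer_num m i (root_of T) (root_of S)"
    and "labelled_edges (graft m i S T) =
      move_edges (outer_num m i (root_of T)) (labelled_edges S) \<union>
      move_edges (inner_num i) (labelled_edges T)"
proof -
  note num = numbering[OF i root_of_in[OF T]]
  note rS = relabel_ytree[OF S num(1)] and rT = relabel_ytree[OF T num(2)]
  note gl = glue_ytree[OF rS(1) rT(1), unfolded root_of_relabel, OF num(3)]
  show "ytree_on {1..n + m - 1} (graft m i S T)"
    "root_of (graft m i S T) = outer_num m i (root_of T) (root_of S)"
    "labelled_edges (graft m i S T) =
      move_edges (outer_num m i (root_of T)) (labelled_edges S) \<union>
      move_edges (inner_num i) (labelled_edges T)"
    using gl rS rT num(4) by (simp_all add: graft_eq_glue)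
qed

lemma move_edges_cong:
  assumes "ytree_on V T" "\<And>v. v \<in> V \<Longrightarrow> s v = t v"
  shows "move_edges s (labelled_edges T) = move_edges t (labelled_edges T)"
  unfolding move_edges_def
  using assms(2) labelled_edge_vertices[OF assms(1)] by (intro image_cong) auto

lemma relabel_permutes:
  assumes "s permutes {1..n}" "ytree_on {1..n} T"
  shows "ytree_on {1..n} (relabel s T)"
    and "labelled_edges (relabel s T) = move_edges s (labelled_edges T)"
  using relabel_ytree[OF assms(2) permutes_inj_on[OF assms(1)]] permutes_image[OF assms(1)]
  by simp_all

lemma perm_comp_inner:
  assumes i: "i \<in> {1..n}" and t: "t permutes {1..m}" and w: "w \<in> {1..m}"
  shows "perm_comp n m i s t (inner_num i w) = inner_num (s i) (t w)"
  using i w by (auto simp: perm_comp_def inner_num_def)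

lemma perm_comp_outer:
  assumes i: "i \<in> {1..n}" and s: "s permutes {1..n}" and v: "v \<in> {1..n}" "v \<noteq> i"
  shows "perm_comp n m i s t (outer_num m i r v) = outer_num m (s i) r' (s v)"
proof -
  have "s v \<noteq> s i" using permutes_inj[OF s] v by (auto dest: injD)
  then show ?thesis
    using i v by (cases v i rule: linorder_cases) (auto simp: perm_comp_def outer_num_def Let_def)
qed

text \<open>
  The two blocks of \<open>{1..n + m - 1}\<close> for the composition at \<open>i\<close> are sent onto the two blocks for
  the composition at \<open>s i\<close>, so \<open>perm_comp\<close> is surjective on a finite set.
\<close>

lemma perm_comp_permutes:
  assumes i: "i \<in> {1..n}" and s: "s permutes {1..n}" and t: "t permutes {1..m}"
  shows "perm_comp n m i s t permutes {1..n + m - 1}"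
proof -
  let ?p = "perm_comp n m i s t"
  have si: "s i \<in> {1..n}" using i s by (simp add: permutes_in_image del: atLeastAtMost_iff)
  \<comment> \<open>The root \<open>0\<close> is a placeholder: it is relevant for the vertex \<open>i\<close> only.\<close>
  have "?p ` {1..n + m - 1} = ?p ` outer_num m i 0 ` ({1..n} - {i}) \<union> ?p ` inner_num i ` {1..m}"
    using numbering_cover[OF i, of m 0] by (metis image_Un)
  also have "?p ` outer_num m i 0 ` ({1..n} - {i}) = outer_num m (s i) 0 ` s ` ({1..n} - {i})"
    unfolding image_image by (intro image_cong refl perm_comp_outer[OF i s]) auto
  also have "s ` ({1..n} - {i}) = {1..n} - {s i}"
    using permutes_image[OF s] permutes_inj[OF s] by (simp add: image_set_diff)
  also have "?p ` inner_num i ` {1..m} = inner_num (s i) ` t ` {1..m}"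
    unfolding image_image by (intro image_cong refl perm_comp_inner[OF i t])
  also have "outer_num m (s i) 0 ` ({1..n} - {s i}) \<union> inner_num (s i) ` t ` {1..m} = {1..n + m - 1}"
    unfolding permutes_image[OF t] by (rule numbering_cover[OF si])
  finally have img: "?p ` {1..n + m - 1} = {1..n + m - 1}" .
  have "inj_on ?p {1..n + m - 1}"
    by (rule eq_card_imp_inj_on) (simp_all only: img finite_atLeastAtMost)
  moreover have "?p k = k" if "k \<notin> {1..n + m - 1}" for k
    using that i by (auto simp: perm_comp_def)
  ultimately show ?thesis
    using img by (intro bij_imp_permutes) (auto simp: bij_betw_def)
qed

lemma perm_comp_num:
  assumes i: "i \<in> {1..n}" and s: "s permutes {1..n}" and t: "t permutes {1..m}"
    and r: "r \<in> {1..m}" and v: "v \<in> {1..n}"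
  shows "perm_comp n m i s t (outer_num m i r v) = outer_num m (s i) (t r) (s v)"
  using perm_comp_outer[OF i s v] perm_comp_inner[OF i t r]
  by (cases "v = i") (auto simp: outer_num_root)

lemma unit_ytree: "ytree_on {1..1} ((1, {}), \<lambda>_. undefined)"
  by (auto simp: ytree_on_def rooted_tree_def)

text \<open>
  Both sides have the same labelled edges because \<open>perm_comp\<close> intertwines the renumberings at
  \<open>i\<close> and at \<open>s i\<close>. The two associativity laws below reduce to identities between renumberings
  in the same way.
\<close>

lemma graft_relabel:
  assumes i: "i \<in> {1..n}" and s: "s permutes {1..n}" and t: "t permutes {1..m}"
    and x: "ytree_on {1..n} x" and y: "ytree_on {1..m} y"
  shows "graft m (s i) (relabel s x) (relabel t y) =
    relabel (perm_comp n m i s t) (graft m i x y)"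
proof (rule ytree_eqI)
  have si: "s i \<in> {1..n}" using i s by (simp add: permutes_in_image del: atLeastAtMost_iff)
  note ry = root_of_in[OF y]
  note num = perm_comp_num[OF i s t ry] and perm = perm_comp_permutes[OF i s t]
  note gr = graft_ytree[OF i x y]
    and gr' = graft_ytree[OF si relabel_permutes(1)[OF s x] relabel_permutes(1)[OF t y]]
  note rg = relabel_permutes[OF perm gr(1)]
  show "ytree_on {1..n + m - 1} (graft m (s i) (relabel s x) (relabel t y))" by (fact gr'(1))
  show "ytree_on {1..n + m - 1}
      (relabel (perm_comp n m i s t) (graft m i x y))" by (fact rg(1))
  show "root_of (graft m (s i) (relabel s x) (relabel t y)) =
      root_of (relabel (perm_comp n m i s t) (graft m i x y))"
    by (simp add: gr(2) gr'(2) num[OF root_of_in[OF x]])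
  have "move_edges (outer_num m (s i) (t (root_of y)) \<circ> s) (labelled_edges x) =
      move_edges (perm_comp n m i s t \<circ> outer_num m i (root_of y)) (labelled_edges x)"
    by (rule move_edges_cong[OF x]) (simp add: num)
  moreover have "move_edges (inner_num (s i) \<circ> t) (labelled_edges y) =
      move_edges (perm_comp n m i s t \<circ> inner_num i) (labelled_edges y)"
    by (rule move_edges_cong[OF y]) (simp add: perm_comp_inner[OF i t])
  ultimately show "labelled_edges (graft m (s i) (relabel s x) (relabel t y)) =
      labelled_edges (relabel (perm_comp n m i s t) (graft m i x y))"
    by (simp add: gr'(3) rg(2) gr(3) relabel_permutes(2)[OF s x] relabel_permutes(2)[OF t y]
        move_edges_Un move_edges_comp)
qed

lemma graft_assoc:
  assumes i: "i \<in> {1..n}" and j: "j \<in> {1..m}"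
    and x: "ytree_on {1..n} x" and y: "ytree_on {1..m} y" and z: "ytree_on {1..l} z"
  shows "graft l (i + j - 1) (graft m i x y) z = graft (m + l - 1) i x (graft l j y z)"
proof (rule ytree_eqI)
  have ij: "i + j - 1 \<in> {1..n + m - 1}" using i j by auto
  note xy = graft_ytree[OF i x y] and yz = graft_ytree[OF j y z]
  note L = graft_ytree[OF ij xy(1) z] and R = graft_ytree[OF i x yz(1)]
  have rx: "root_of x \<in> {1..n}" and ry: "root_of y \<in> {1..m}" and rz: "root_of z \<in> {1..l}"
    using x y z root_of_in by blast+
  have outer: "outer_num l (i + j - 1) (root_of z) (outer_num m i (root_of y) v) =
      outer_num (m + l - 1) i (outer_num l j (root_of z) (root_of y)) v" if "v \<in> {1..n}" for v
    using that i j ry rz by (cases v i rule: linorder_cases) (auto simp: outer_num_def)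
  have middle: "outer_num l (i + j - 1) (root_of z) (inner_num i v) =
      inner_num i (outer_num l j (root_of z) v)" if "v \<in> {1..m}" for v
    using that i j ry rz
    by (cases v j rule: linorder_cases) (auto simp: outer_num_def inner_num_def)
  have inner: "inner_num (i + j - 1) v = inner_num i (inner_num j v)" if "v \<in> {1..l}" for v
    using that i j by (auto simp: inner_num_def)
  show "ytree_on {1..n + m - 1 + l - 1} (graft l (i + j - 1) (graft m i x y) z)" by (fact L(1))
  show "ytree_on {1..n + (m + l - 1) - 1} (graft (m + l - 1) i x (graft l j y z))" by (fact R(1))
  show "root_of (graft l (i + j - 1) (graft m i x y) z) =
      root_of (graft (m + l - 1) i x (graft l j y z))"
    by (simp only: L(2) R(2) xy(2) yz(2) outer[OF rx])
  have "move_edges (outer_num l (i + j - 1) (root_of z) \<circ> outer_num m i (root_of y)) (labelled_edges x) =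
      move_edges (outer_num (m + l - 1) i (outer_num l j (root_of z) (root_of y))) (labelled_edges x)"
    by (rule move_edges_cong[OF x]) (simp only: o_apply outer)
  moreover have "move_edges (outer_num l (i + j - 1) (root_of z) \<circ> inner_num i) (labelled_edges y) =
      move_edges (inner_num i \<circ> outer_num l j (root_of z)) (labelled_edges y)"
    by (rule move_edges_cong[OF y]) (simp only: o_apply middle)
  moreover have "move_edges (inner_num (i + j - 1)) (labelled_edges z) =
      move_edges (inner_num i \<circ> inner_num j) (labelled_edges z)"
    by (rule move_edges_cong[OF z]) (simp only: o_apply inner)
  ultimately show "labelled_edges (graft l (i + j - 1) (graft m i x y) z) =
      labelled_edges (graft (m + l - 1) i x (graft l j y z))"
    by (simp only: L(3) R(3) xy yz move_edges_Un move_edges_comp Un_assoc)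
qed

lemma graft_commute:
  assumes i: "i \<in> {1..n}" and k: "k \<in> {1..n}" and ik: "i < k"
    and x: "ytree_on {1..n} x" and y: "ytree_on {1..m} y" and z: "ytree_on {1..l} z"
  shows "graft l (k + m - 1) (graft m i x y) z = graft m i (graft l k x z) y"
proof (rule ytree_eqI)
  have rx: "root_of x \<in> {1..n}" and ry: "root_of y \<in> {1..m}" and rz: "root_of z \<in> {1..l}"
    using x y z root_of_in by blast+
  have k': "k + m - 1 \<in> {1..n + m - 1}" and i': "i \<in> {1..n + l - 1}"
    using i k ry rz by auto
  note xy = graft_ytree[OF i x y] and xz = graft_ytree[OF k x z]
  note L = graft_ytree[OF k' xy(1) z] and R = graft_ytree[OF i' xz(1) y]
  have outer: "outer_num l (k + m - 1) (root_of z) (outer_num m i (root_of y) v) =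
      outer_num m i (root_of y) (outer_num l k (root_of z) v)" if "v \<in> {1..n}" for v
    using that i k ik ry rz
    by (cases v i rule: linorder_cases; cases v k rule: linorder_cases) (auto simp: outer_num_def)
  have inner_y: "outer_num l (k + m - 1) (root_of z) (inner_num i v) = inner_num i v"
    if "v \<in> {1..m}" for v
    using that i k ik by (auto simp: outer_num_def inner_num_def)
  have inner_z: "inner_num (k + m - 1) v = outer_num m i (root_of y) (inner_num k v)"
    if "v \<in> {1..l}" for v
    using that i k ik ry by (auto simp: outer_num_def inner_num_def)
  show "ytree_on {1..n + m - 1 + l - 1} (graft l (k + m - 1) (graft m i x y) z)" by (fact L(1))
  show "ytree_on {1..n + l - 1 + m - 1} (graft m i (graft l k x z) y)" by (fact R(1))
  show "root_of (graft l (k + m - 1) (graft m i x y) z) = root_of (graft m i (graft l k x z) y)"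
    by (simp only: L(2) R(2) xy(2) xz(2) outer[OF rx])
  have "move_edges (outer_num l (k + m - 1) (root_of z) \<circ> outer_num m i (root_of y)) (labelled_edges x) =
      move_edges (outer_num m i (root_of y) \<circ> outer_num l k (root_of z)) (labelled_edges x)"
    by (rule move_edges_cong[OF x]) (simp only: o_apply outer)
  moreover have "move_edges (outer_num l (k + m - 1) (root_of z) \<circ> inner_num i) (labelled_edges y) =
      move_edges (inner_num i) (labelled_edges y)"
    by (rule move_edges_cong[OF y]) (simp only: o_apply inner_y)
  moreover have "move_edges (inner_num (k + m - 1)) (labelled_edges z) =
      move_edges (outer_num m i (root_of y) \<circ> inner_num k) (labelled_edges z)"
    by (rule move_edges_cong[OF z]) (simp only: o_apply inner_z)
  ultimately show "labelled_edges (graft l (k + m - 1) (graft m i x y) z) =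
      labelled_edges (graft m i (graft l k x z) y)"
    by (simp only: L(3) R(3) xy xz move_edges_Un move_edges_comp Un_ac)
qed

lemma move_edges_id: "move_edges (\<lambda>v. v) L = L"
  by (simp add: move_edges_def map_prod.id[unfolded id_def] id_def)

lemma graft_unit_left:
  assumes x: "ytree_on {1..n} x"
  shows "graft n 1 ((1, {}), \<lambda>_. undefined) x = x"
proof (rule ytree_eqI[OF _ x])
  note gr = graft_ytree[OF _ unit_ytree x, of 1]
  show "ytree_on {1..1 + n - 1} (graft n 1 ((1, {}), \<lambda>_. undefined) x)" by (rule gr) simp
  show "root_of (graft n 1 ((1, {}), \<lambda>_. undefined) x) = root_of x"
    using gr(2) by (simp add: outer_num_def)
  show "labelled_edges (graft n 1 ((1, {}), \<lambda>_. undefined) x) = labelled_edges x"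
    using gr(3) by (simp add: inner_num_def[abs_def] move_edges_id)
qed

lemma graft_unit_right:
  assumes i: "i \<in> {1..n}" and x: "ytree_on {1..n} x"
  shows "graft 1 i x ((1, {}), \<lambda>_. undefined) = x"
proof (rule ytree_eqI[OF _ x])
  note gr = graft_ytree[OF i x unit_ytree]
  have num: "outer_num (Suc 0) i (Suc 0) = (\<lambda>v. v)" by (auto simp: outer_num_def)
  show "ytree_on {1..n + 1 - 1} (graft 1 i x ((1, {}), \<lambda>_. undefined))" by (rule gr)
  show "root_of (graft 1 i x ((1, {}), \<lambda>_. undefined)) = root_of x"
    using gr(2) by (simp add: num)
  show "labelled_edges (graft 1 i x ((1, {}), \<lambda>_. undefined)) = labelled_edges x"
    using gr(3) by (simp add: num move_edges_id)
qed

lemma NAP_simps [simp]: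
  "act NAP n = relabel" "cmp NAP n = graft" "unit NAP = ((1, {}), \<lambda>_. undefined)"
  by (simp_all add: NAP_def)

lemma relabel_permutes_comp:
  assumes "s permutes {1..n}" "t permutes {1..n}" "ytree_on {1..n} x"
  shows "relabel (s \<circ> t) x = relabel s (relabel t x)"
  using relabel_relabel[OF assms(3)] assms(1,2) by (metis permutes_inj_on)

lemma operad_NAP: "operad (NAP :: 'y::topological_space ytree operad_data)"
  unfolding operad_def NAP_simps elems_NAP mem_Collect_eq
  by (intro conjI allI impI;
      rule relabel_permutes(1) relabel_id relabel_permutes_comp unit_ytree graft_ytree(1)
        graft_unit_left graft_unit_right graft_assoc graft_commute graft_relabel;
      assumption)

section \<open>Quotients by operad ideals\<close>

lemma ideal_equiv: "operad_ideal P R \<Longrightarrow> equiv (elems P n) (R n)"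
  by (simp add: operad_ideal_def)

lemma ideal_refl: "operad_ideal P R \<Longrightarrow> x \<in> elems P n \<Longrightarrow> (x, x) \<in> R n"
  by (meson ideal_equiv equivE refl_onD)

lemma elems_quotient_operad [simp]: "elems (quotient_operad P R) n = elems P n // R n"
  by (simp add: quotient_operad_def)

lemma unit_quotient_operad [simp]: "unit (quotient_operad P R) = R 1 `` {unit P}"
  by (simp add: quotient_operad_def)

text \<open>
  The structure maps of the quotient saturate a set of results of all representatives; that set
  lies in one class and contains the result for the chosen representatives.
\<close>

lemma Image_part_of_class:
  assumes "equiv A R" "a \<in> B" "B \<subseteq> R `` {a}"
  shows "R `` B = R `` {a}"
  using assms by (auto simp: equiv_def dest: transD)

lemma act_quotient_operad:
  assumes R: "operad_ideal P R" and s: "s permutes {1..n}" and x: "x \<in> elems P n"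
  shows "act (quotient_operad P R) n s (R n `` {x}) = R n `` {act P n s x}"
proof -
  have "(x, x) \<in> R n" using ideal_equiv[OF R] x by (simp add: equiv_def refl_on_def)
  then have "act P n s x \<in> act P n s ` (R n `` {x})" by blast
  moreover have "act P n s ` (R n `` {x}) \<subseteq> R n `` {act P n s x}"
    using R s by (auto simp: operad_ideal_def)
  ultimately have "R n `` (act P n s ` (R n `` {x})) = R n `` {act P n s x}"
    by (rule Image_part_of_class[OF ideal_equiv[OF R]])
  then show ?thesis by (simp add: quotient_operad_def)
qed

lemma cmp_quotient_operad:
  assumes R: "operad_ideal P R" and i: "i \<in> {1..n}" and x: "x \<in> elems P n" and y: "y \<in> elems P m"
  shows "cmp (quotient_operad P R) n m i (R n `` {x}) (R m `` {y}) =
    R (n + m - 1) `` {cmp P n m i x y}"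
proof -
  let ?C = "{cmp P n m i x' y' | x' y'. x' \<in> R n `` {x} \<and> y' \<in> R m `` {y}}"
  have "(x, x) \<in> R n" "(y, y) \<in> R m"
    using ideal_equiv[OF R] x y by (auto simp: equiv_def refl_on_def)
  then have "cmp P n m i x y \<in> ?C" by blast
  moreover have "?C \<subseteq> R (n + m - 1) `` {cmp P n m i x y}"
    using R i unfolding operad_ideal_def by blast
  ultimately have "R (n + m - 1) `` ?C = R (n + m - 1) `` {cmp P n m i x y}"
    by (rule Image_part_of_class[OF ideal_equiv[OF R]])
  then show ?thesis by (simp add: quotient_operad_def)
qed

lemma operad_morphism_quotient:
  assumes P: "operad P" and R: "operad_ideal P R"
  shows "operad_morphism P (quotient_operad P R) (\<lambda>n x. R n `` {x})"
  using act_quotient_operad[OF R] cmp_quotient_operad[OF R]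
  by (simp add: operad_morphism_def quotientI)

text \<open>
  Every class has a representative and the structure maps can be computed on representatives, so
  each axiom is inherited. Equivariance also needs that \<open>perm_comp\<close> is a permutation.
\<close>

lemma operad_quotient:
  assumes P: "operad P" and R: "operad_ideal P R"
  shows "operad (quotient_operad P R)"
proof -
  note act = act_quotient_operad[OF R] and cmp = cmp_quotient_operad[OF R]
  have act_in: "s permutes {1..n} \<Longrightarrow> x \<in> elems P n \<Longrightarrow> act P n s x \<in> elems P n"
    and act_id: "x \<in> elems P n \<Longrightarrow> act P n id x = x"
    and act_comp: "s permutes {1..n} \<Longrightarrow> t permutes {1..n} \<Longrightarrow> x \<in> elems P n \<Longrightarrow>
        act P n (s \<circ> t) x = act P n s (act P n t x)"
    and unit_in: "unit P \<in> elems P 1"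
    and cmp_in: "i \<in> {1..n} \<Longrightarrow> x \<in> elems P n \<Longrightarrow> y \<in> elems P m \<Longrightarrow>
        cmp P n m i x y \<in> elems P (n + m - 1)"
    and unit_left: "x \<in> elems P n \<Longrightarrow> cmp P 1 n 1 (unit P) x = x"
    and unit_right: "i \<in> {1..n} \<Longrightarrow> x \<in> elems P n \<Longrightarrow> cmp P n 1 i x (unit P) = x"
    and assoc: "i \<in> {1..n} \<Longrightarrow> j \<in> {1..m} \<Longrightarrow>
        x \<in> elems P n \<Longrightarrow> y \<in> elems P m \<Longrightarrow> z \<in> elems P l \<Longrightarrow>
        cmp P (n + m - 1) l (i + j - 1) (cmp P n m i x y) z =
        cmp P n (m + l - 1) i x (cmp P m l j y z)"
    and commute: "i \<in> {1..n} \<Longrightarrow> k \<in> {1..n} \<Longrightarrow> i < k \<Longrightarrow>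
        x \<in> elems P n \<Longrightarrow> y \<in> elems P m \<Longrightarrow> z \<in> elems P l \<Longrightarrow>
        cmp P (n + m - 1) l (k + m - 1) (cmp P n m i x y) z =
        cmp P (n + l - 1) m i (cmp P n l k x z) y"
    and equivariant: "i \<in> {1..n} \<Longrightarrow> s permutes {1..n} \<Longrightarrow> t permutes {1..m} \<Longrightarrow>
        x \<in> elems P n \<Longrightarrow> y \<in> elems P m \<Longrightarrow>
        cmp P n m (s i) (act P n s x) (act P m t y) =
        act P (n + m - 1) (perm_comp n m i s t) (cmp P n m i x y)"
    for s t n m l i j k x y z
    using P unfolding operad_def by (simp_all del: atLeastAtMost_iff One_nat_def)
  show ?thesis
    unfolding operad_def elems_quotient_operad unit_quotient_operad
  proof (intro conjI allI impI)
    show "R 1 `` {unit P} \<in> elems P 1 // R 1" by (rule quotientI[OF unit_in])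
  next
    fix n s X assume "s permutes {1..n}" "X \<in> elems P n // R n"
    then show "act (quotient_operad P R) n s X \<in> elems P n // R n"
      by (auto elim!: quotientE simp: act intro!: quotientI act_in)
  next
    fix n X assume "X \<in> elems P n // R n"
    then show "act (quotient_operad P R) n id X = X"
      by (auto elim!: quotientE simp: act permutes_id act_id)
  next
    fix n s t X assume "s permutes {1..n}" "t permutes {1..n}" "X \<in> elems P n // R n"
    then show "act (quotient_operad P R) n (s \<circ> t) X =
        act (quotient_operad P R) n s (act (quotient_operad P R) n t X)"
      by (auto elim!: quotientE simp: act act_in permutes_compose act_comp)
  next
    fix n m i X Y assume "i \<in> {1..n}" "X \<in> elems P n // R n" "Y \<in> elems P m // R m"
    then show "cmp (quotient_operad P R) n m i X Y \<in> elems P (n + m - 1) // R (n + m - 1)"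
      by (auto elim!: quotientE simp: cmp simp del: atLeastAtMost_iff One_nat_def intro!: quotientI cmp_in)
  next
    fix n X assume "X \<in> elems P n // R n"
    then obtain x where "x \<in> elems P n" "X = R n `` {x}" by (rule quotientE)
    then show "cmp (quotient_operad P R) 1 n 1 (R 1 `` {unit P}) X = X"
      using cmp[of 1 1 "unit P" x n] unit_in unit_left by simp
  next
    fix n i X assume "i \<in> {1..n}" "X \<in> elems P n // R n"
    moreover from this obtain x where "x \<in> elems P n" "X = R n `` {x}" by (elim quotientE)
    ultimately show "cmp (quotient_operad P R) n 1 i X (R 1 `` {unit P}) = X"
      using cmp[of i n x "unit P" 1] unit_in unit_right by simp
  next
    fix n m l i j X Y Z
    assume ij: "i \<in> {1..n}" "j \<in> {1..m}"
      and "X \<in> elems P n // R n" "Y \<in> elems P m // R m" "Z \<in> elems P l // R l"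
    then obtain x y z where xyz: "x \<in> elems P n" "y \<in> elems P m" "z \<in> elems P l"
      and eq: "X = R n `` {x}" "Y = R m `` {y}" "Z = R l `` {z}" by (elim quotientE)
    have "i + j - 1 \<in> {1..n + m - 1}" "n + m - 1 + l - 1 = n + (m + l - 1) - 1"
      using ij by auto
    then show "cmp (quotient_operad P R) (n + m - 1) l (i + j - 1)
          (cmp (quotient_operad P R) n m i X Y) Z =
        cmp (quotient_operad P R) n (m + l - 1) i X (cmp (quotient_operad P R) m l j Y Z)"
      using cmp[OF _ cmp_in[OF ij(1) xyz(1,2)] xyz(3)]
        cmp[OF ij(1) xyz(1) cmp_in[OF ij(2) xyz(2,3)]] cmp ij xyz assoc[OF ij xyz]
      by (simp add: eq del: atLeastAtMost_iff)
  next
    fix n m l i k X Y Z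
    assume ik: "i \<in> {1..n}" "k \<in> {1..n}" "i < k"
      and "X \<in> elems P n // R n" "Y \<in> elems P m // R m" "Z \<in> elems P l // R l"
    then obtain x y z where xyz: "x \<in> elems P n" "y \<in> elems P m" "z \<in> elems P l"
      and eq: "X = R n `` {x}" "Y = R m `` {y}" "Z = R l `` {z}" by (elim quotientE)
    have "k + m - 1 \<in> {1..n + m - 1}" "i \<in> {1..n + l - 1}" using ik by auto
    moreover have "n + m - 1 + l - 1 = n + l - 1 + m - 1" using ik by auto
    ultimately show "cmp (quotient_operad P R) (n + m - 1) l (k + m - 1)
          (cmp (quotient_operad P R) n m i X Y) Z =
        cmp (quotient_operad P R) (n + l - 1) m i (cmp (quotient_operad P R) n l k X Z) Y"
      using cmp[OF _ cmp_in[OF ik(1) xyz(1,2)] xyz(3)]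
        cmp[OF _ cmp_in[OF ik(2) xyz(1,3)] xyz(2)] cmp ik xyz commute[OF ik xyz]
      by (simp add: eq del: atLeastAtMost_iff)
  next
    fix n m i s t X Y
    assume ist: "i \<in> {1..n}" "s permutes {1..n}" "t permutes {1..m}"
      and "X \<in> elems P n // R n" "Y \<in> elems P m // R m"
    then obtain x y where xy: "x \<in> elems P n" "y \<in> elems P m"
      and eq: "X = R n `` {x}" "Y = R m `` {y}" by (elim quotientE)
    have "s i \<in> {1..n}" using ist(1,2) by (simp add: permutes_in_image del: atLeastAtMost_iff)
    then show "cmp (quotient_operad P R) n m (s i) (act (quotient_operad P R) n s X)
          (act (quotient_operad P R) m t Y) =
        act (quotient_operad P R) (n + m - 1) (perm_comp n m i s t)
          (cmp (quotient_operad P R) n m i X Y)"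
      using cmp[OF _ act_in[OF ist(2) xy(1)] act_in[OF ist(3) xy(2)]] cmp[OF ist(1) xy]
        act[OF perm_comp_permutes[OF ist] cmp_in[OF ist(1) xy]] act ist xy equivariant[OF ist xy]
      by (simp add: eq del: atLeastAtMost_iff)
  qed
qed

section \<open>Reductions\<close>

text \<open>
  A reduction on an arbitrary vertex set, expressed by labelled edges. The vertex \<open>i\<close> is not the
  root because it has the incoming edge \<open>k \<rightarrow> i\<close>.
\<close>

definition reduces :: "'y \<Rightarrow> nat set \<Rightarrow> 'y ytree \<Rightarrow> 'y ytree \<Rightarrow> bool" where
  "reduces b V T T' \<longleftrightarrow> ytree_on V T \<and> ytree_on V T' \<and> root_of T' = root_of T \<and>
     (\<exists>k i j y. ((k, i), y) \<in> labelled_edges T \<and> ((i, j), b) \<in> labelled_edges T \<and>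
        labelled_edges T' = insert ((k, j), y) (labelled_edges T - {((i, j), b)}))"

lemma reduct_eq:
  assumes tree: "rooted_tree V (r, E)" and ki: "(k, i) \<in> E"
  shows "reduct ((r, E), f) i j = ((r, insert (k, j) (E - {(i, j)})),
      restrict (f((k, j) := f (k, i))) (insert (k, j) (E - {(i, j)})))"
proof -
  have "(THE k. (k, i) \<in> E) = k" using tree ki by (auto simp: rooted_tree_def)
  then show ?thesis by (simp add: reduct_def Let_def)
qed

text \<open>
  The edge created by a reduction is new, so no label is overwritten, and the edge \<open>k \<rightarrow> i\<close> that
  supplies its label is not the one that is removed.
\<close>

lemma edge_to_grandchild:
  assumes tree: "rooted_tree V (r, E)" and ki: "(k, i) \<in> E" and ij: "(i, j) \<in> E"
  shows "k \<noteq> i" and "(k, j) \<notin> E"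
proof -
  have parent: "\<And>i i' j. (i, j) \<in> E \<Longrightarrow> (i', j) \<in> E \<Longrightarrow> i = i'" and iV: "i \<in> V"
    using tree ki by (auto simp: rooted_tree_def)
  show "k \<noteq> i" using no_cycle_in_rooted_tree[OF tree iV] ki by auto
  then show "(k, j) \<notin> E" using parent ij by blast
qed

lemma reduct_ytree:
  assumes T: "ytree_on V T"
    and ki: "((k, i), y) \<in> labelled_edges T" and ij: "((i, j), b) \<in> labelled_edges T"
  shows "ytree_on V (reduct T i j)" and "root_of (reduct T i j) = root_of T"
    and "labelled_edges (reduct T i j) = insert ((k, j), y) (labelled_edges T - {((i, j), b)})"
proof -
  obtain r E f where T_eq: "T = ((r, E), f)" by (metis surj_pair)
  have E: "rooted_tree V (r, E)" "(k, i) \<in> E" "(i, j) \<in> E" and y: "y = f (k, i)" "b = f (i, j)"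
    using T ki ij by (auto simp: T_eq ytree_on_def labelled_edges_def)
  note red = reduct_eq[OF E(1,2), of f j, folded T_eq]
  show "ytree_on V (reduct T i j)"
    using rooted_tree_move_up[OF E] by (simp add: red ytree_on_def)
  show "root_of (reduct T i j) = root_of T" unfolding red by (simp add: T_eq)
  show "labelled_edges (reduct T i j) = insert ((k, j), y) (labelled_edges T - {((i, j), b)})"
    using edge_to_grandchild(2)[OF E] E(3) unfolding red y by (auto simp: T_eq labelled_edges_def)
qed

lemma red_step_eq_reduces: "red_step b n = reduces b {1..n}"
proof (intro ext iffI)
  fix T T' :: "'a ytree"
  assume "red_step b n T T'"
  then obtain i j where T: "ytree_on {1..n} T" and red: "reducible b T i j" "T' = reduct T i j"
    by (auto simp: red_step_def elems_NAP)
  obtain r E f where T_eq: "T = ((r, E), f)" by (metis surj_pair)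
  have ij: "(i, j) \<in> E" "i \<noteq> r" "f (i, j) = b" using red by (auto simp: reducible_def T_eq)
  then have "(r, i) \<in> E\<^sup>*" using T by (auto simp: T_eq ytree_on_def rooted_tree_def)
  then obtain k where "(k, i) \<in> E" using ij(2) by (metis rtranclE)
  then have e: "((k, i), f (k, i)) \<in> labelled_edges T" "((i, j), b) \<in> labelled_edges T"
    using ij by (auto simp: T_eq labelled_edges_def)
  show "reduces b {1..n} T T'"
    unfolding reduces_def red(2) using T e reduct_ytree[OF T e] by (intro conjI exI)
next
  fix T T' :: "'a ytree"
  assume "reduces b {1..n} T T'"
  then obtain k i j y where T: "ytree_on {1..n} T" "ytree_on {1..n} T'" "root_of T' = root_of T"
    and e: "((k, i), y) \<in> labelled_edges T" "((i, j), b) \<in> labelled_edges T"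
    and T': "labelled_edges T' = insert ((k, j), y) (labelled_edges T - {((i, j), b)})"
    unfolding reduces_def by blast
  have "T' = reduct T i j"
    using ytree_eqI[OF T(2) reduct_ytree(1)[OF T(1) e]] reduct_ytree(2,3)[OF T(1) e] T(3) T' by simp
  moreover have "reducible b T i j"
    using e T(1) by (auto simp: reducible_def labelled_edges_def ytree_on_def rooted_tree_def
        split: prod.splits)
  ultimately show "red_step b n T T'"
    using T(1) by (auto simp: red_step_def elems_NAP)
qed

lemma reduces_relabel:
  assumes red: "reduces b V T T'" and inj: "inj_on s V"
  shows "reduces b (s ` V) (relabel s T) (relabel s T')"
proof -
  obtain k i j y where T: "ytree_on V T" "ytree_on V T'" "root_of T' = root_of T"
    and e: "((k, i), y) \<in> labelled_edges T" "((i, j), b) \<in> labelled_edges T"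
    and T': "labelled_edges T' = insert ((k, j), y) (labelled_edges T - {((i, j), b)})"
    using red unfolding reduces_def by blast
  let ?s = "map_prod (map_prod s s) id :: (nat \<times> nat) \<times> 'a \<Rightarrow> _"
  have "labelled_edges T \<subseteq> (V \<times> V) \<times> UNIV"
    using labelled_edge_vertices[OF T(1)] by auto
  moreover have "inj_on ?s ((V \<times> V) \<times> UNIV)"
    using inj by (intro map_prod_inj_on inj_on_id)
  ultimately have "?s ` (labelled_edges T - {((i, j), b)}) =
      ?s ` labelled_edges T - ?s ` {((i, j), b)}"
    using e(2) by (intro inj_on_image_set_diff[where C = "(V \<times> V) \<times> UNIV"]) auto
  then have "move_edges s (labelled_edges T') =
      insert ((s k, s j), y) (move_edges s (labelled_edges T) - {((s i, s j), b)})"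
    by (simp add: T' move_edges_def)
  moreover have "((s k, s i), y) \<in> move_edges s (labelled_edges T)"
    "((s i, s j), b) \<in> move_edges s (labelled_edges T)"
    using e[THEN imageI, of ?s] by (simp_all add: move_edges_def)
  ultimately show ?thesis
    using relabel_ytree[OF T(1) inj] relabel_ytree[OF T(2) inj] T(3)
    unfolding reduces_def by (simp only: root_of_relabel) blast
qed

text \<open>
  Gluing at a vertex only adds labelled edges and changes no incoming edge of a vertex of the
  first tree. The edge sets of the two trees are disjoint, so the removed edge is not put back
  by the other tree.
\<close>

lemma reduces_glue_left:
  assumes red: "reduces b V S S'" and T: "ytree_on V' T" and meet: "V \<inter> V' = {root_of T}"
  shows "reduces b (V \<union> V') (glue S T) (glue S' T)"
proof -
  obtain k i j y where S: "ytree_on V S" "ytree_on V S'" "root_of S' = root_of S"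
    and e: "((k, i), y) \<in> labelled_edges S" "((i, j), b) \<in> labelled_edges S"
    and S': "labelled_edges S' = insert ((k, j), y) (labelled_edges S - {((i, j), b)})"
    using red unfolding reduces_def by blast
  note gl = glue_ytree[OF S(1) T meet] and gl' = glue_ytree[OF S(2) T meet]
  have "((i, j), b) \<notin> labelled_edges T"
    using gl(3) e(2) by (auto simp: labelled_edges_def)
  then have "labelled_edges (glue S' T) =
      insert ((k, j), y) (labelled_edges (glue S T) - {((i, j), b)})"
    unfolding gl(2) gl'(2) S' by blast
  with gl(1) gl'(1) S(3) e show ?thesis
    unfolding reduces_def gl(2) root_of_glue by blast
qed

lemma reduces_glue_right:
  assumes red: "reduces b V' T T'" and S: "ytree_on V S" and meet: "V \<inter> V' = {root_of T}"
  shows "reduces b (V \<union> V') (glue S T) (glue S T')"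
proof -
  obtain k i j y where T: "ytree_on V' T" "ytree_on V' T'" "root_of T' = root_of T"
    and e: "((k, i), y) \<in> labelled_edges T" "((i, j), b) \<in> labelled_edges T"
    and T': "labelled_edges T' = insert ((k, j), y) (labelled_edges T - {((i, j), b)})"
    using red unfolding reduces_def by blast
  note gl = glue_ytree[OF S T(1) meet]
  note gl' = glue_ytree[OF S T(2), unfolded T(3), OF meet]
  have "((i, j), b) \<notin> labelled_edges S"
    using gl(3) e(2) by (auto simp: labelled_edges_def)
  then have "labelled_edges (glue S T') =
      insert ((k, j), y) (labelled_edges (glue S T) - {((i, j), b)})"
    unfolding gl(2) gl'(2) T' by blast
  with gl(1) gl'(1) e show ?thesis
    unfolding reduces_def gl(2) root_of_glue by blast
qed

lemma reduces_graft:
  assumes i: "i \<in> {1..n}"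
  shows "reduces b {1..n} S S' \<Longrightarrow> ytree_on {1..m} T \<Longrightarrow>
      reduces b {1..n + m - 1} (graft m i S T) (graft m i S' T)"
    and "ytree_on {1..n} S \<Longrightarrow> reduces b {1..m} T T' \<Longrightarrow>
      reduces b {1..n + m - 1} (graft m i S T) (graft m i S T')"
proof -
  assume red: "reduces b {1..n} S S'" and T: "ytree_on {1..m} T"
  note num = numbering[OF i root_of_in[OF T]]
  show "reduces b {1..n + m - 1} (graft m i S T) (graft m i S' T)"
    using reduces_glue_left[OF reduces_relabel[OF red num(1)] relabel_ytree(1)[OF T num(2)]]
    unfolding graft_eq_glue root_of_relabel num(3,4) by blast
next
  assume S: "ytree_on {1..n} S" and red: "reduces b {1..m} T T'"
  then have T: "ytree_on {1..m} T" and root: "root_of T' = root_of T" by (auto simp: reduces_def)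
  note num = numbering[OF i root_of_in[OF T]]
  show "reduces b {1..n + m - 1} (graft m i S T) (graft m i S T')"
    using reduces_glue_right[OF reduces_relabel[OF red num(2)] relabel_ytree(1)[OF S num(1)]]
    unfolding graft_eq_glue root_of_relabel num(3,4) root by blast
qed

lemma equivclp_map:
  assumes "\<And>x x'. r x x' \<Longrightarrow> r' (f x) (f x')" and "equivclp r x x'"
  shows "equivclp r' (f x) (f x')"
  using assms(2)
proof (induction rule: equivclp_induct)
  case (step y z)
  then have "equivclp r' (f y) (f z)" using assms(1) by (metis r_into_equivclp equivclp_sym)
  with step.IH show ?case by (rule equivclp_trans)
qed simp

lemma red_equiv_iff:
  "(T, T') \<in> red_equiv b n \<longleftrightarrow>
     ytree_on {1..n} T \<and> ytree_on {1..n} T' \<and> equivclp (reduces b {1..n}) T T'"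
  by (simp add: red_equiv_def elems_NAP red_step_eq_reduces)

text \<open>
  Relabelling and grafting in either argument send single reductions to single reductions, hence
  chains of reductions and their inverses to such chains.
\<close>

lemma operad_ideal_red_equiv: "operad_ideal NAP (red_equiv b)"
  unfolding operad_ideal_def NAP_simps
proof (intro conjI allI impI)
  show "equiv (elems NAP n) (red_equiv b n)" for n
    by (rule equivI)
      (auto simp: refl_on_def sym_def trans_def red_equiv_iff elems_NAP
        intro: equivclp_sym equivclp_trans)
next
  fix n s and x x' :: "'a ytree"
  assume s: "s permutes {1..n}" and "(x, x') \<in> red_equiv b n"
  moreover have "reduces b {1..n} (relabel s x) (relabel s x')" if "reduces b {1..n} x x'" for x x'
    using reduces_relabel[OF that permutes_inj_on[OF s]] permutes_image[OF s] by simp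
  ultimately show "(relabel s x, relabel s x') \<in> red_equiv b n"
    using relabel_permutes(1)[OF s, where 'a = 'a] equivclp_map[of "reduces b {1..n}" _ "relabel s"]
    by (simp add: red_equiv_iff del: One_nat_def)
next
  fix n m i and x x' y y' :: "'a ytree"
  assume i: "i \<in> {1..n}" and "(x, x') \<in> red_equiv b n" "(y, y') \<in> red_equiv b m"
  then have x: "ytree_on {1..n} x" "ytree_on {1..n} x'" "equivclp (reduces b {1..n}) x x'"
    and y: "ytree_on {1..m} y" "ytree_on {1..m} y'" "equivclp (reduces b {1..m}) y y'"
    by (simp_all only: red_equiv_iff)
  have "equivclp (reduces b {1..n + m - 1}) (graft m i x y) (graft m i x' y)"
    using reduces_graft(1)[OF i _ y(1)] x(3) by (rule equivclp_map)
  also have "equivclp (reduces b {1..n + m - 1}) (graft m i x' y) (graft m i x' y')"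
    using reduces_graft(2)[OF i x(2)] y(3) by (rule equivclp_map)
  finally (equivclp_trans) show "(graft m i x y, graft m i x' y') \<in> red_equiv b (n + m - 1)"
    unfolding red_equiv_iff by (intro conjI graft_ytree(1)[OF i] x y)
qed

section \<open>The ideal generated by the relation in arity 3\<close>

lemma labelled_edges_chain3: "labelled_edges (chain3 y z) = {((1, 2), y), ((2, 3), z)}"
  by (auto simp: labelled_edges_def chain3_def)

lemma labelled_edges_cherry3: "labelled_edges (cherry3 y z) = {((1, 2), y), ((1, 3), z)}"
  by (auto simp: labelled_edges_def cherry3_def)

lemma root_of_chain3 [simp]: "root_of (chain3 y z) = 1"
  by (simp add: chain3_def)

lemma root_of_cherry3 [simp]: "root_of (cherry3 y z) = 1"
  by (simp add: cherry3_def)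

lemma atLeastAtMost_1_3: "{1..3} = {1, 2, 3::nat}"
  by auto

lemma chain3_ytree: "ytree_on {1..3} (chain3 y z)"
proof -
  let ?E = "{(1, 2), (2, 3::nat)}"
  have "(1, 2) \<in> ?E\<^sup>*" "(2, 3) \<in> ?E\<^sup>*" by blast+
  then have "(1, 3) \<in> ?E\<^sup>*" by (rule rtrancl_trans)
  with \<open>(1, 2) \<in> ?E\<^sup>*\<close> have "rooted_tree {1, 2, 3} (1, ?E)"
    unfolding rooted_tree_def by auto
  then show ?thesis unfolding ytree_on_def atLeastAtMost_1_3 by (simp add: chain3_def)
qed

lemma reduct_chain3: "reduct (chain3 y b) 2 3 = cherry3 y y"
proof -
  have "(THE k::nat. (k, 2) \<in> {(1, 2), (2, 3::nat)}) = 1" by auto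
  then show ?thesis
    by (auto simp: reduct_def chain3_def cherry3_def Let_def restrict_def intro!: ext)
qed

lemma reduces_chain3: "reduces b {1..3} (chain3 y b) (cherry3 y y)"
proof -
  have "((1, 2), y) \<in> labelled_edges (chain3 y b)" "((2, 3), b) \<in> labelled_edges (chain3 y b)"
    by (simp_all add: labelled_edges_chain3)
  note e = this and red = reduct_ytree[OF chain3_ytree this]
  show ?thesis
    unfolding reduces_def using chain3_ytree e red unfolding reduct_chain3 by (intro conjI exI)
qed

lemma basic_relation_subset_red_equiv: "basic_relation b n \<subseteq> red_equiv b n"
proof -
  have "(chain3 y b, cherry3 y y) \<in> red_equiv b 3" for y
    unfolding red_equiv_iff using reduces_chain3[of b y]
    unfolding reduces_def[of b "{1..3}" "chain3 y b"]
    by (metis r_into_equivclp reduces_chain3)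
  then show ?thesis by (auto simp: basic_relation_def)
qed

text \<open>
  The extension of a family of relations \<open>R\<close> to trees on a finite vertex set \<open>V\<close>, by numbering
  the vertices. For an ideal \<open>R\<close> the choice of the numbering does not matter. Equality of roots
  is required because the renumbering in a graft depends on the root of the inner tree.
\<close>

definition ideal_on ::
  "(nat \<Rightarrow> ('y ytree \<times> 'y ytree) set) \<Rightarrow> nat set \<Rightarrow> 'y ytree \<Rightarrow> 'y ytree \<Rightarrow> bool" where
  "ideal_on R V T T' \<longleftrightarrow> ytree_on V T \<and> ytree_on V T' \<and> root_of T = root_of T' \<and>
     (\<exists>a. bij_betw a V {1..card V} \<and> (relabel a T, relabel a T') \<in> R (card V))"

text \<open>
  Numberings of two trees induce one of their union, namely that of the graft. The same
  numbering \<open>c\<close> serves all pairs of trees on the two vertex sets, which allows either tree to be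
  replaced by an equivalent one.
\<close>

lemma glue_relabels_to_graft:
  assumes a: "bij_betw a V {1..n}" and a': "bij_betw a' V' {1..m}" and meet: "V \<inter> V' = {v}"
  obtains c where "bij_betw c (V \<union> V') {1..n + m - 1}"
    and "\<And>S T. ytree_on V S \<Longrightarrow> ytree_on V' T \<Longrightarrow> root_of T = v \<Longrightarrow>
      relabel c (glue S T) = graft m (a v) (relabel a S) (relabel a' T)"
proof
  let ?g = "outer_num m (a v) (a' v)" and ?h = "inner_num (a v)"
  define c where "c = (\<lambda>u. if u \<in> V then ?g (a u) else ?h (a' u))"
  have v: "v \<in> V" "v \<in> V'" using meet by auto
  then have av: "a v \<in> {1..n}" "a' v \<in> {1..m}"
    using a a' by (auto simp: bij_betw_def simp del: atLeastAtMost_iff)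
  note num = numbering[OF av]
  have c: "c u = (?g \<circ> a) u" if "u \<in> V" for u using that by (simp add: c_def)
  have c': "c u = (?h \<circ> a') u" if "u \<in> V'" for u
  proof (cases "u \<in> V")
    case True
    with that meet have "u = v" by auto
    with v show ?thesis by (simp add: c_def outer_num_root)
  qed (simp add: c_def)
  have img: "a ` V = {1..n}" "a' ` V' = {1..m}" and inj: "inj_on a V" "inj_on a' V'"
    using a a' by (simp_all add: bij_betw_def)
  have cV: "c ` V = ?g ` {1..n}" and cV': "c ` V' = ?h ` {1..m}"
    using c c' img by (metis image_cong image_comp)+
  have cinj: "inj_on c V" "inj_on c V'"
  proof -
    have "inj_on (?g \<circ> a) V" "inj_on (?h \<circ> a') V'"
      using comp_inj_on[OF inj(1), of ?g] comp_inj_on[OF inj(2), of ?h] num(1,2) unfolding img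
      by blast+
    then show "inj_on c V" "inj_on c V'" using c c' by (simp_all add: inj_on_def)
  qed
  have union: "c ` (V \<union> V') = {1..n + m - 1}"
    using num(4) by (simp only: image_Un cV cV')
  have inj_c: "inj_on c (V \<union> V')"
  proof (rule inj_onI)
    \<comment> \<open>Equal new numbers in different parts are that of the merged vertex.\<close>
    have cross: "u = w" if "u \<in> V" "w \<in> V'" "c u = c w" for u w
    proof -
      have "c u \<in> ?g ` {1..n} \<inter> ?h ` {1..m}" using that cV cV' by blast
      then have "c u = ?h (a' v)" unfolding num(3) by simp
      then have "c u = c v" using c'[OF v(2)] by simp
      then show ?thesis using that cinj v by (metis inj_onD)
    qed
    fix u w assume "u \<in> V \<union> V'" "w \<in> V \<union> V'" "c u = c w"
    then show "u = w" using cross[of u w] cross[of w u] cinj by (metis UnE inj_onD)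
  qed
  with union show "bij_betw c (V \<union> V') {1..n + m - 1}" by (simp add: bij_betw_def)
  fix S T :: "'b ytree"
  assume S: "ytree_on V S" and T: "ytree_on V' T" and root: "root_of T = v"
  have "relabel c (glue S T) = glue (relabel c S) (relabel c T)"
    using relabel_glue(1)[OF S T _ inj_c] meet root by simp
  also have "relabel c S = relabel (?g \<circ> a) S"
    by (rule relabel_cong[OF S c cinj(1)])
  also have "\<dots> = relabel ?g (relabel a S)"
    using relabel_relabel[OF S inj(1)] num(1) img(1) by metis
  also have "relabel c T = relabel (?h \<circ> a') T"
    by (rule relabel_cong[OF T c' cinj(2)])
  also have "\<dots> = relabel ?h (relabel a' T)"
    using relabel_relabel[OF T inj(2)] num(2) img(2) by metis
  finally show "relabel c (glue S T) = graft m (a v) (relabel a S) (relabel a' T)"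
    by (simp add: graft_eq_glue root)
qed

lemma finite_numbering:
  assumes "finite V"
  obtains a where "bij_betw a V {1..card V}"
  using finite_same_card_bij[OF assms, of "{1..card V}"] by auto

lemma ideal_on_glue:
  assumes R: "operad_ideal NAP R" and fin: "finite V" "finite V'" and meet: "V \<inter> V' = {root_of T}"
  shows "ideal_on R V S S' \<Longrightarrow> ytree_on V' T \<Longrightarrow> ideal_on R (V \<union> V') (glue S T) (glue S' T)"
    and "ytree_on V S \<Longrightarrow> ideal_on R V' T T' \<Longrightarrow> ideal_on R (V \<union> V') (glue S T) (glue S T')"
proof -
  have card: "card (V \<union> V') = card V + card V' - 1"
    using card_Un_Int[OF fin] meet by simp
  have v: "root_of T \<in> V" "root_of T \<in> V'" using meet by auto
  have cmp: "(graft m i x y, graft m i x' y') \<in> R (n + m - 1)"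
    if "i \<in> {1..n}" "(x, x') \<in> R n" "(y, y') \<in> R m" for n m i x x' y y'
    using R that unfolding operad_ideal_def NAP_simps by blast
  have refl: "(x, x) \<in> R n" if "ytree_on {1..n} x" for n x
    by (rule ideal_refl[OF R]) (simp add: elems_NAP that del: One_nat_def)
  {
    assume S: "ideal_on R V S S'" and T: "ytree_on V' T"
    then obtain a where a: "bij_betw a V {1..card V}" "(relabel a S, relabel a S') \<in> R (card V)"
      by (auto simp: ideal_on_def)
    obtain a' where a': "bij_betw a' V' {1..card V'}" using finite_numbering[OF fin(2)] .
    obtain c where c: "bij_betw c (V \<union> V') {1..card V + card V' - 1}"
      and gr: "\<And>S. ytree_on V S \<Longrightarrow>
        relabel c (glue S T) = graft (card V') (a (root_of T)) (relabel a S) (relabel a' T)"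
      using glue_relabels_to_graft[OF a(1) a' meet] T by metis
    have "a (root_of T) \<in> {1..card V}" using a(1) v by (metis bij_betwE)
    moreover have "(relabel a' T, relabel a' T) \<in> R (card V')"
      using relabel_ytree(1)[OF T] a' by (intro refl) (metis bij_betw_def)
    ultimately have "(relabel c (glue S T), relabel c (glue S' T)) \<in> R (card V + card V' - 1)"
      using cmp a(2) gr S by (simp only: ideal_on_def)
    then show "ideal_on R (V \<union> V') (glue S T) (glue S' T)"
      using c S glue_ytree(1)[OF _ T meet] unfolding ideal_on_def card root_of_glue
      by (intro conjI exI[of _ c]) simp_all
  next
    assume S: "ytree_on V S" and T: "ideal_on R V' T T'"
    then obtain a' where a': "bij_betw a' V' {1..card V'}"
        "(relabel a' T, relabel a' T') \<in> R (card V')"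
      by (auto simp: ideal_on_def)
    obtain a where a: "bij_betw a V {1..card V}" using finite_numbering[OF fin(1)] .
    obtain c where c: "bij_betw c (V \<union> V') {1..card V + card V' - 1}"
      and gr: "\<And>T'. ytree_on V' T' \<Longrightarrow> root_of T' = root_of T \<Longrightarrow>
        relabel c (glue S T') = graft (card V') (a (root_of T)) (relabel a S) (relabel a' T')"
      using glue_relabels_to_graft[OF a a'(1) meet] S by metis
    have "a (root_of T) \<in> {1..card V}" using a(1) v by (metis bij_betwE)
    moreover have "(relabel a S, relabel a S) \<in> R (card V)"
      using relabel_ytree(1)[OF S] a by (intro refl) (metis bij_betw_def)
    ultimately have "(relabel c (glue S T), relabel c (glue S T')) \<in> R (card V + card V' - 1)"
      using cmp a'(2) gr T by (simp only: ideal_on_def)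
    moreover have "ytree_on (V \<union> V') (glue S T)" "ytree_on (V \<union> V') (glue S T')"
      using glue_ytree(1)[OF S] T meet by (auto simp: ideal_on_def)
    ultimately show "ideal_on R (V \<union> V') (glue S T) (glue S T')"
      using c unfolding ideal_on_def card root_of_glue by (intro conjI exI[of _ c]) simp_all
  }
qed

lemma ideal_onD:
  assumes R: "operad_ideal NAP R" and T: "ideal_on R {1..n} T T'"
  shows "(T, T') \<in> R n"
proof -
  obtain a where a: "bij_betw a {1..n} {1..n}" "(relabel a T, relabel a T') \<in> R n"
    and T: "ytree_on {1..n} T" "ytree_on {1..n} T'"
    using T by (auto simp: ideal_on_def)
  define s where "s = (\<lambda>k. if k \<in> {1..n} then a k else k)"
  have s: "s permutes {1..n}"
  proof (rule bij_imp_permutes)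
    show "bij_betw s {1..n} {1..n}"
      using a(1) by (rule bij_betw_cong[THEN iffD1, rotated]) (simp add: s_def)
  qed (auto simp: s_def)
  have inv: "relabel (inv s) (relabel a x) = x" if x: "ytree_on {1..n} x" for x :: "'a ytree"
  proof -
    have "relabel a x = relabel s x"
      using a(1) by (intro relabel_cong[OF x]) (auto simp: s_def bij_betw_def)
    then have "relabel (inv s) (relabel a x) = relabel (inv s \<circ> s) x"
      using relabel_permutes_comp[OF permutes_inv[OF s] s x] by simp
    then show ?thesis using relabel_id[OF x] permutes_inv_o(2)[OF s] by simp
  qed
  have "(relabel (inv s) (relabel a T), relabel (inv s) (relabel a T')) \<in> R n"
    using R permutes_inv[OF s] a(2) unfolding operad_ideal_def NAP_simps by blast
  then show ?thesis by (simp only: inv T)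
qed

lemma ideal_on_relabel:
  assumes T: "ytree_on {1..n} T" "ytree_on {1..n} T'" "root_of T = root_of T'"
    and TT': "(T, T') \<in> R n" and s: "inj_on s {1..n}"
  shows "ideal_on R (s ` {1..n}) (relabel s T) (relabel s T')"
proof -
  let ?a = "inv_into {1..n} s"
  have card: "card (s ` {1..n}) = n" using card_image[OF s] by simp
  have inv: "relabel ?a (relabel s x) = x" if x: "ytree_on {1..n} x" for x :: "'a ytree"
  proof -
    have "relabel ?a (relabel s x) = relabel (?a \<circ> s) x"
      by (rule relabel_relabel[OF x s]) (simp add: inj_on_inv_into)
    also have "\<dots> = relabel id x"
    proof (rule relabel_cong[OF x])
      show inv: "(?a \<circ> s) v = id v" if "v \<in> {1..n}" for v
        using inv_into_f_f[OF s that] by simp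
      show "inj_on (?a \<circ> s) {1..n}" by (rule inj_onI) (metis inv id_apply)
    qed
    finally show ?thesis using relabel_id[OF x] by simp
  qed
  have "bij_betw ?a (s ` {1..n}) {1..n}"
    using s by (simp add: bij_betw_inv_into inj_on_imp_bij_betw)
  moreover have "(relabel ?a (relabel s T), relabel ?a (relabel s T')) \<in> R n"
    using TT' by (simp only: inv T)
  ultimately show ?thesis
    using relabel_ytree(1)[OF T(1) s] relabel_ytree(1)[OF T(2) s] T(3)
    unfolding ideal_on_def card root_of_relabel by metis
qed

definition subtree :: "nat \<Rightarrow> nat set \<Rightarrow> 'y ytree \<Rightarrow> 'y ytree" where
  "subtree r W T = ((r, snd (fst T) \<inter> W \<times> W), restrict (snd T) (snd (fst T) \<inter> W \<times> W))"

lemma root_of_subtree [simp]: "root_of (subtree r W T) = r"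
  by (simp add: subtree_def)

lemma subtree_ytree:
  "rooted_tree W (r, snd (fst T) \<inter> W \<times> W) \<Longrightarrow> ytree_on W (subtree r W T)"
  by (simp add: subtree_def ytree_on_def)

lemma labelled_edges_subtree:
  "labelled_edges (subtree r W T) = (\<lambda>e. (e, snd T e)) ` (snd (fst T) \<inter> W \<times> W)"
  by (auto simp: labelled_edges_def subtree_def)

text \<open>
  The tree is cut into \<open>A\<close> around \<open>k\<close>, \<open>B\<close> hanging from \<open>i\<close> and \<open>C\<close> hanging from \<open>j\<close>. It and its
  reduction are the same composite of \<open>A\<close>, \<open>B\<close>, \<open>C\<close> with the chain and the cherry, respectively.
\<close>

lemma reduces_imp_ideal_on:
  fixes b :: "'y::topological_space"
  assumes R: "operad_ideal NAP R" and basic: "\<And>n. basic_relation b n \<subseteq> R n"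
    and fin: "finite V" and red: "reduces b V T T'"
  shows "ideal_on R V T T'"
proof -
  obtain k i j y where T: "ytree_on V T" "ytree_on V T'" "root_of T' = root_of T"
    and e: "((k, i), y) \<in> labelled_edges T" "((i, j), b) \<in> labelled_edges T"
    and T': "labelled_edges T' = insert ((k, j), y) (labelled_edges T - {((i, j), b)})"
    using red unfolding reduces_def by blast
  define r E f where "r = fst (fst T)" and "E = snd (fst T)" and "f = snd T"
  then have tree: "rooted_tree V (r, E)" and root: "root_of T = r"
    and ki: "(k, i) \<in> E" and ij: "(i, j) \<in> E" and y: "f (k, i) = y" "f (i, j) = b"
    using T(1) e by (auto simp: ytree_on_def root_of_def labelled_edges_def)
  define Di where "Di = E\<^sup>* `` {i}"
  define Ei where "Ei = E \<inter> Di \<times> Di"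
  define Dj where "Dj = Ei\<^sup>* `` {j}"
  have iV: "i \<in> V" using tree ki by (auto simp: rooted_tree_def)
  note below_i = rooted_tree_descendants[OF tree iV, folded Di_def, folded Ei_def]
  note cut_i = rooted_tree_nondescendants[OF tree ki, folded Di_def, folded Ei_def]
  have ij': "(i, j) \<in> Ei" using ij unfolding Ei_def Di_def by auto
  then have jDi: "j \<in> Di" by (auto simp: Ei_def)
  note below_j = rooted_tree_descendants[OF below_i jDi, folded Dj_def]
  note cut_j = rooted_tree_nondescendants[OF below_i ij', folded Dj_def]
  have Ej: "Ei \<inter> Dj \<times> Dj = E \<inter> Dj \<times> Dj" "Ei \<inter> (Di - Dj) \<times> (Di - Dj) = E \<inter> (Di - Dj) \<times> (Di - Dj)"
    using cut_j(3) by (auto simp: Ei_def)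
  have jDj: "j \<in> Dj" and iDi: "i \<in> Di" by (auto simp: Dj_def Di_def)
  define A B C where "A = subtree r (V - Di) T" and "B = subtree i (Di - Dj) T"
    and "C = subtree j Dj T"
  have A: "ytree_on (V - Di) A" and B: "ytree_on (Di - Dj) B" and C: "ytree_on Dj C"
    using cut_i(1) cut_j(1) below_j unfolding A_def B_def C_def Ej E_def
    by (auto intro!: subtree_ytree)
  have roots: "root_of A = r" "root_of B = i" "root_of C = j"
    by (simp_all add: A_def B_def C_def)
  have distinct: "k \<noteq> i" "i \<noteq> j" "k \<noteq> j" using cut_i(2) cut_j(2) iDi jDi jDj by auto
  \<comment> \<open>The chain and the cherry of the basic relation, moved to the vertices \<open>k\<close>, \<open>i\<close>, \<open>j\<close>.\<close>
  define s where "s = (\<lambda>v::nat. if v = 1 then k else if v = 2 then i else j)"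
  have s: "inj_on s {1..3}" "s ` {1..3} = {k, i, j}"
    unfolding atLeastAtMost_1_3 using distinct by (auto simp: s_def inj_on_def)
  define S S' where "S = relabel s (chain3 y b)" and "S' = relabel s (cherry3 y y)"
  have cherry3_ytree: "ytree_on {1..3} (cherry3 y y)"
    using reduces_chain3[of b y] by (simp add: reduces_def)
  have "(chain3 y b, cherry3 y y) \<in> R 3" using basic[of 3] by (auto simp: basic_relation_def)
  then have base: "ideal_on R {k, i, j} S S'"
    unfolding S_def S'_def s(2)[symmetric]
    by (intro ideal_on_relabel[OF chain3_ytree cherry3_ytree _ _ s(1)]) simp_all
  then have S: "ytree_on {k, i, j} S" "ytree_on {k, i, j} S'" by (simp_all add: ideal_on_def)
  have S_root: "root_of S = k" "root_of S' = k" by (simp_all add: S_def S'_def s_def)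
  have "labelled_edges S = {((k, i), y), ((i, j), b)}"
    unfolding S_def relabel_ytree(2)[OF chain3_ytree s(1)] labelled_edges_chain3
    by (simp add: move_edges_def s_def)
  moreover have "labelled_edges S' = {((k, i), y), ((k, j), y)}"
    unfolding S'_def relabel_ytree(2)[OF cherry3_ytree s(1)] labelled_edges_cherry3
    by (simp add: move_edges_def s_def)
  ultimately have S_edges: "labelled_edges S = {((k, i), y), ((i, j), b)}"
    "labelled_edges S' = {((k, i), y), ((k, j), y)}" .
  have meet_B: "{k, i, j} \<inter> (Di - Dj) = {root_of B}"
    using cut_i(2) cut_j(2) jDj iDi by (auto simp: roots)
  have meet_C: "({k, i, j} \<union> (Di - Dj)) \<inter> Dj = {root_of C}"
    using cut_i(2) cut_j(2,3) jDj iDi by (auto simp: roots)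
  have union_C: "{k, i, j} \<union> (Di - Dj) \<union> Dj = insert k Di"
    using cut_j(3) iDi jDi by auto
  have meet_A: "(V - Di) \<inter> insert k Di = {k}"
    using cut_i(2) by auto
  have union_A: "(V - Di) \<union> insert k Di = V"
    using cut_i(2,3) by auto
  have fins: "finite (V - Di)" "finite Di" "finite Dj"
    using fin finite_subset[OF cut_i(3) fin] finite_subset[OF cut_j(3)] by auto
  let ?G = "\<lambda>S. glue A (glue (glue S B) C)"
  \<comment> \<open>For \<open>X\<close> the chain this composite is \<open>T\<close>, for \<open>X\<close> the cherry it is the reduction. Disjointness
    shows that the edge \<open>i \<rightarrow> j\<close> is removed from the chain only.\<close>
  have G: "ytree_on V (?G X)" "root_of (?G X) = r"
      "labelled_edges (?G X) = labelled_edges A \<union> (labelled_edges X \<union> labelled_edges B \<union> labelled_edges C)"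
      "labelled_edges X \<inter> labelled_edges A = {}" "labelled_edges X \<inter> labelled_edges B = {}"
      "labelled_edges X \<inter> labelled_edges C = {}"
    if X: "ytree_on {k, i, j} X" "root_of X = k" for X :: "'y ytree"
  proof -
    note g1 = glue_ytree[OF X(1) B meet_B]
    note g2 = glue_ytree[OF g1(1) C meet_C, unfolded union_C]
    have "(V - Di) \<inter> insert k Di = {root_of (glue (glue X B) C)}" using meet_A X(2) by simp
    note g3 = glue_ytree[OF A g2(1) this, unfolded union_A]
    show "ytree_on V (?G X)" "root_of (?G X) = r"
      "labelled_edges (?G X) = labelled_edges A \<union> (labelled_edges X \<union> labelled_edges B \<union> labelled_edges C)"
      using g1 g2 g3 by (simp_all add: roots)
    have "snd (fst X) \<subseteq> snd (fst (glue X B))" "snd (fst (glue X B)) \<subseteq> snd (fst (glue (glue X B) C))"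
      by (simp_all add: glue_def)
    then show "labelled_edges X \<inter> labelled_edges A = {}" "labelled_edges X \<inter> labelled_edges B = {}"
      "labelled_edges X \<inter> labelled_edges C = {}"
      using g1(3) g2(3) g3(3) by (auto simp: labelled_edges_def)
  qed
  have "E = E \<inter> (V - Di) \<times> (V - Di) \<union> {(k, i)} \<union>
      (E \<inter> (Di - Dj) \<times> (Di - Dj) \<union> {(i, j)} \<union> E \<inter> Dj \<times> Dj)"
    using cut_i(4) cut_j(4) unfolding Ej by simp
  then have "(\<lambda>e. (e, f e)) ` E = (\<lambda>e. (e, f e)) ` (E \<inter> (V - Di) \<times> (V - Di) \<union> {(k, i)} \<union>
      (E \<inter> (Di - Dj) \<times> (Di - Dj) \<union> {(i, j)} \<union> E \<inter> Dj \<times> Dj))" by simp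
  then have T_edges: "labelled_edges T = labelled_edges A \<union> {((k, i), y)} \<union>
      (labelled_edges B \<union> {((i, j), b)} \<union> labelled_edges C)"
    unfolding A_def B_def C_def labelled_edges_subtree image_Un
    by (simp add: labelled_edges_def y flip: E_def f_def)
  have "T = ?G S"
  proof (rule ytree_eqI[OF T(1) G(1)[OF S(1) S_root(1)]])
    show "root_of T = root_of (?G S)" using G(2)[OF S(1) S_root(1)] root by simp
    show "labelled_edges T = labelled_edges (?G S)"
      unfolding G(3)[OF S(1) S_root(1)] S_edges T_edges by blast
  qed
  moreover have "T' = ?G S'"
  proof (rule ytree_eqI[OF T(2) G(1)[OF S(2) S_root(2)]])
    show "root_of T' = root_of (?G S')" using G(2)[OF S(2) S_root(2)] root T(3) by simp
    have "((i, j), b) \<notin> labelled_edges A" "((i, j), b) \<notin> labelled_edges B"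
      "((i, j), b) \<notin> labelled_edges C" "((i, j), b) \<noteq> ((k, i), y)"
      using G(4-6)[OF S(1) S_root(1)] distinct unfolding S_edges by auto
    then show "labelled_edges T' = labelled_edges (?G S')"
      unfolding G(3)[OF S(2) S_root(2)] S_edges T' T_edges by blast
  qed
  moreover have "ideal_on R V (?G S) (?G S')"
  proof -
    have 1: "ideal_on R ({k, i, j} \<union> (Di - Dj)) (glue S B) (glue S' B)"
      using ideal_on_glue(1)[OF R _ _ meet_B base B] fins by simp
    have 2: "ideal_on R (insert k Di) (glue (glue S B) C) (glue (glue S' B) C)"
      using ideal_on_glue(1)[OF R _ _ meet_C 1 C] fins unfolding union_C by simp
    have "(V - Di) \<inter> insert k Di = {root_of (glue (glue S B) C)}"
      using meet_A S_root by simp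
    from ideal_on_glue(2)[OF R _ _ this A 2] show ?thesis using fins unfolding union_A by simp
  qed
  ultimately show ?thesis by simp
qed

lemma generated_ideal_basic_relation:
  "generated_ideal NAP (basic_relation b) n = red_equiv b n"
proof
  show "generated_ideal NAP (basic_relation b) n \<subseteq> red_equiv b n"
    unfolding generated_ideal_def
    using operad_ideal_red_equiv basic_relation_subset_red_equiv by blast
  show "red_equiv b n \<subseteq> generated_ideal NAP (basic_relation b) n"
    unfolding generated_ideal_def
  proof (intro subrelI InterI, clarify)
    fix T T' and R :: "nat \<Rightarrow> ('a ytree \<times> 'a ytree) set"
    assume R: "operad_ideal NAP R" "\<forall>k. basic_relation b k \<subseteq> R k" and "(T, T') \<in> red_equiv b n"
    then have T: "ytree_on {1..n} T" and "equivclp (reduces b {1..n}) T T'"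
      by (simp_all only: red_equiv_iff)
    from this(2) show "(T, T') \<in> R n"
    proof (induction rule: equivclp_induct)
      case base
      show ?case by (rule ideal_refl[OF R(1)]) (simp add: elems_NAP T del: One_nat_def)
    next
      case (step U W)
      have "(x, x') \<in> R n" if "reduces b {1..n} x x'" for x x'
        using reduces_imp_ideal_on[OF R(1) _ _ that] R(2) by (intro ideal_onD[OF R(1)]) auto
      then have "(U, W) \<in> R n"
        using step.hyps(2) ideal_equiv[OF R(1), of n] unfolding equiv_def by (blast dest: symD)
      with step.IH show ?case
        using ideal_equiv[OF R(1), of n] unfolding equiv_def by (blast dest: transD)
    qed
  qed
qed

section \<open>Continuity of relabelling and grafting\<close>

lemma continuous_map_from_sum:
  assumes "\<And>i. i \<in> I \<Longrightarrow> continuous_map (X i) Z (\<lambda>x. f (i, x))"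
  shows "continuous_map (sum_topology X I) Z f"
  unfolding continuous_map_def openin_sum_topology topspace_sum_topology
proof (intro conjI allI impI ballI)
  show "f \<in> Sigma I (topspace \<circ> X) \<rightarrow> topspace Z"
    using assms by (fastforce simp: continuous_map_def)
next
  fix U i assume "openin Z U" and i: "i \<in> I"
  then have "openin (X i) {x \<in> topspace (X i). f (i, x) \<in> U}"
    using assms by (simp add: continuous_map_def)
  also have "{x \<in> topspace (X i). f (i, x) \<in> U} = {x. (i, x) \<in> {x \<in> Sigma I (topspace \<circ> X). f x \<in> U}}"
    using i by auto
  finally show "openin (X i) \<dots>" .
qed auto

text \<open>
  A product of two disjoint unions is the disjoint union of the products of the summands, so
  continuity may be checked on those.
\<close>

lemma continuous_map_from_prod_sum:
  assumes cont: "\<And>i j. i \<in> I \<Longrightarrow> j \<in> J \<Longrightarrow>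
      continuous_map (prod_topology (X i) (Y j)) Z (\<lambda>(x, y). f ((i, x), (j, y)))"
  shows "continuous_map (prod_topology (sum_topology X I) (sum_topology Y J)) Z f"
  unfolding continuous_map_def
proof (intro conjI allI impI)
  show "f \<in> topspace (prod_topology (sum_topology X I) (sum_topology Y J)) \<rightarrow> topspace Z"
  proof clarsimp
    fix i x j y assume "i \<in> I" "j \<in> J" "x \<in> topspace (X i)" "y \<in> topspace (Y j)"
    then show "f ((i, x), (j, y)) \<in> topspace Z"
      using funcset_mem[OF continuous_map_funspace[OF cont[of i j]], of "(x, y)"] by simp
  qed
next
  fix U assume U: "openin Z U"
  let ?P = "{p \<in> topspace (prod_topology (sum_topology X I) (sum_topology Y J)). f p \<in> U}"
  show "openin (prod_topology (sum_topology X I) (sum_topology Y J)) ?P"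
    unfolding openin_prod_topology_alt
  proof (intro allI impI)
    fix p q assume pq: "(p, q) \<in> ?P"
    obtain i x j y where eq: "p = (i, x)" "q = (j, y)" by (metis surj_pair)
    with pq have ij: "i \<in> I" "j \<in> J" and xy: "x \<in> topspace (X i)" "y \<in> topspace (Y j)"
      and fU: "f ((i, x), (j, y)) \<in> U" by auto
    let ?Q = "{z \<in> topspace (prod_topology (X i) (Y j)). (case z of (x, y) \<Rightarrow> f ((i, x), (j, y))) \<in> U}"
    have "openin (prod_topology (X i) (Y j)) ?Q"
      using cont[OF ij] U unfolding continuous_map_def by blast
    moreover have "(x, y) \<in> ?Q" using xy fU by simp
    ultimately obtain A B where AB: "openin (X i) A" "openin (Y j) B" "x \<in> A" "y \<in> B" "A \<times> B \<subseteq> ?Q"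
      unfolding openin_prod_topology_alt by meson
    have "openin (sum_topology X I) (Pair i ` A)" "openin (sum_topology Y J) (Pair j ` B)"
      using open_map_component_injection[of i I X] open_map_component_injection[of j J Y] ij AB
      unfolding open_map_def by blast+
    moreover have "p \<in> Pair i ` A" "q \<in> Pair j ` B" using AB eq by auto
    moreover have "Pair i ` A \<times> Pair j ` B \<subseteq> ?P" using AB(5) ij by auto
    ultimately show "\<exists>U V. openin (sum_topology X I) U \<and> openin (sum_topology Y J) V \<and>
        p \<in> U \<and> q \<in> V \<and> U \<times> V \<subseteq> ?P" by blast
  qed
qed

abbreviation labellings :: "(nat \<times> nat) set \<Rightarrow> (nat \<times> nat \<Rightarrow> 'y::topological_space) topology" where
  "labellings E \<equiv> product_topology (\<lambda>_. euclidean) E"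

lemma arity_NAP: "arity NAP n = nap_space n"
  by (simp add: NAP_def)

lemma continuous_map_into_nap_space:
  assumes "rooted_tree {1..n} (r, E)" "continuous_map X (labellings E) F"
  shows "continuous_map X (nap_space n) (\<lambda>x. ((r, E), F x))"
proof -
  have "continuous_map (labellings E) (nap_space n) (Pair (r, E))"
    using continuous_map_component_injection[of "(r, E)" "{T. rooted_tree {1..n} T}"
        "\<lambda>(r, E). labellings E"] assms(1)
    by (simp add: nap_space_def del: One_nat_def)
  from continuous_map_compose[OF assms(2) this] show ?thesis by (simp add: o_def)
qed

lemma continuous_map_push_labels:
  assumes inj: "inj_on (map_prod g g) E" and e: "e \<in> map_prod g g ` E"
  shows "continuous_map (labellings E) euclidean (\<lambda>f. push_labels g E f e)"
proof -
  have "the_inv_into E (map_prod g g) e \<in> E"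
    using the_inv_into_into[OF inj e] by blast
  from continuous_map_product_projection[OF this] show ?thesis using e by (simp add: push_labels_def)
qed

lemma bare_ytree: "rooted_tree V (r, E) \<Longrightarrow> ytree_on V ((r, E), \<lambda>_. undefined)"
  by (simp add: ytree_on_def extensional_def)

lemma continuous_map_relabel:
  assumes s: "s permutes {1..n}"
  shows "continuous_map (nap_space n) (nap_space n) (relabel s)"
  unfolding nap_space_def[of n, where 'y = 'a]
proof (rule continuous_map_from_sum, clarify, fold nap_space_def)
  fix r E assume tree: "rooted_tree {1..n} (r, E)"
  have tree': "rooted_tree {1..n} (s r, map_prod s s ` E)"
    using rooted_tree_image[OF tree permutes_inj_on[OF s]] permutes_image[OF s] by simp
  have "E \<subseteq> {1..n} \<times> {1..n}" using tree by (simp add: rooted_tree_def)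
  then have inj: "inj_on (map_prod s s) E" by (rule inj_on_edges[OF permutes_inj_on[OF s]])
  have "continuous_map (labellings E) (labellings (map_prod s s ` E)) (push_labels s E)"
    unfolding continuous_map_componentwise
    using continuous_map_push_labels[OF inj] by (intro conjI ballI) (auto simp: push_labels_def)
  then show "continuous_map (labellings E) (nap_space n) (\<lambda>f. relabel s ((r, E), f))"
    unfolding relabel_def prod.case by (rule continuous_map_into_nap_space[OF tree'])
qed

text \<open>
  For fixed underlying trees each label of the graft is one of the labels of the two arguments,
  so every coordinate is a projection.
\<close>

lemma continuous_map_graft:
  assumes i: "i \<in> {1..n}"
  shows "continuous_map (prod_topology (nap_space n) (nap_space m))
    (nap_space (n + m - 1) :: 'y::topological_space ytree topology) (\<lambda>(S, T). graft m i S T)"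
  unfolding nap_space_def[of n, where 'y = 'y] nap_space_def[of m, where 'y = 'y]
proof (rule continuous_map_from_prod_sum)
  fix t1 t2 :: rtree
  assume "t1 \<in> {T. rooted_tree {1..n} T}" "t2 \<in> {T. rooted_tree {1..m} T}"
  then obtain r1 E1 r2 E2 where eq: "t1 = (r1, E1)" "t2 = (r2, E2)"
    and tree: "rooted_tree {1..n} (r1, E1)" "rooted_tree {1..m} (r2, E2)" by (cases t1; cases t2) auto
  let ?g = "outer_num m i r2" and ?h = "inner_num i"
  let ?E1 = "map_prod ?g ?g ` E1" and ?E2 = "map_prod ?h ?h ` E2"
  have "r2 \<in> {1..m}" using tree by (simp add: rooted_tree_def)
  note num = numbering[OF i this]
  have "E1 \<subseteq> {1..n} \<times> {1..n}" "E2 \<subseteq> {1..m} \<times> {1..m}" using tree by (simp_all add: rooted_tree_def)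
  then have inj: "inj_on (map_prod ?g ?g) E1" "inj_on (map_prod ?h ?h) E2"
    using inj_on_edges num(1,2) by blast+
  have tree': "rooted_tree {1..n + m - 1} (?g r1, ?E1 \<union> ?E2)"
    using graft_ytree(1)[OF i tree[THEN bare_ytree[where 'a = 'y]]]
    by (simp add: ytree_on_def graft_def Let_def)
  have 1: "continuous_map (prod_topology (labellings E1) (labellings E2)) euclidean
      (\<lambda>(f1, f2). push_labels ?g E1 f1 e)" if "e \<in> ?E1" for e
    using continuous_map_compose[OF continuous_map_fst continuous_map_push_labels[OF inj(1) that]]
    by (simp add: o_def case_prod_unfold)
  have 2: "continuous_map (prod_topology (labellings E1) (labellings E2)) euclidean
      (\<lambda>(f1, f2). push_labels ?h E2 f2 e)" if "e \<in> ?E2" for e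
    using continuous_map_compose[OF continuous_map_snd continuous_map_push_labels[OF inj(2) that]]
    by (simp add: o_def case_prod_unfold)
  have "continuous_map (prod_topology (labellings E1) (labellings E2)) (labellings (?E1 \<union> ?E2))
      (\<lambda>(f1, f2). \<lambda>e. if e \<in> ?E1 then push_labels ?g E1 f1 e else push_labels ?h E2 f2 e)"
    unfolding continuous_map_componentwise
  proof (intro conjI ballI)
    fix e assume e: "e \<in> ?E1 \<union> ?E2"
    show "continuous_map (prod_topology (labellings E1) (labellings E2)) euclidean
      (\<lambda>x. (case x of (f1, f2) \<Rightarrow> \<lambda>e. if e \<in> ?E1 then push_labels ?g E1 f1 e
        else push_labels ?h E2 f2 e) e)"
      using 1[of e] 2[of e] e by (cases "e \<in> ?E1") (simp_all add: case_prod_unfold)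
  qed (auto simp: push_labels_def extensional_def)
  from continuous_map_into_nap_space[OF tree' this]
  show "continuous_map (prod_topology (case t1 of (r, E) \<Rightarrow> labellings E)
        (case t2 of (r, E) \<Rightarrow> labellings E)) (nap_space (n + m - 1) :: 'y ytree topology)
      (\<lambda>(x, y). case ((t1, x), t2, y) of (S, T) \<Rightarrow> graft m i S T)"
    unfolding eq prod.case by (rule continuous_map_eq) (auto simp: graft_def Let_def)
qed

lemma topological_operad_NAP: "topological_operad (NAP :: 'y::topological_space ytree operad_data)"
  unfolding topological_operad_def arity_NAP NAP_simps
  using operad_NAP continuous_map_relabel continuous_map_graft by blast

section \<open>Quotients of topological operads\<close>

lemma arity_quotient_operad: "arity (quotient_operad P R) n = quotient_space (arity P n) (R n)"
  by (simp add: quotient_operad_def)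

lemma continuous_map_act_quotient:
  assumes P: "topological_operad P" and R: "operad_ideal P R" and s: "s permutes {1..n}"
  shows "continuous_map (arity (quotient_operad P R) n) (arity (quotient_operad P R) n)
    (act (quotient_operad P R) n s)"
  unfolding arity_quotient_operad
proof (rule continuous_compose_quotient_map[OF quotient_map_quotient_space])
  have "continuous_map (arity P n) (arity P n) (act P n s)"
    using P s by (simp add: topological_operad_def)
  from continuous_map_compose[OF this quotient_imp_continuous_map[OF quotient_map_quotient_space]]
  show "continuous_map (arity P n) (quotient_space (arity P n) (R n))
      (act (quotient_operad P R) n s \<circ> (\<lambda>x. R n `` {x}))"
    by (rule continuous_map_eq) (simp add: act_quotient_operad[OF R s])
qed

lemma continuous_map_cmp_classes:
  assumes P: "topological_operad P" and R: "operad_ideal P R" and i: "i \<in> {1..n}"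
  shows "continuous_map (prod_topology (arity P n) (arity P m))
    (arity (quotient_operad P R) (n + m - 1))
    (\<lambda>(x, y). cmp (quotient_operad P R) n m i (R n `` {x}) (R m `` {y}))"
  unfolding arity_quotient_operad
proof -
  have "continuous_map (prod_topology (arity P n) (arity P m)) (arity P (n + m - 1))
      (\<lambda>(x, y). cmp P n m i x y)"
    using P i by (simp add: topological_operad_def del: One_nat_def)
  from continuous_map_compose[OF this quotient_imp_continuous_map[OF quotient_map_quotient_space]]
  show "continuous_map (prod_topology (arity P n) (arity P m))
      (quotient_space (arity P (n + m - 1)) (R (n + m - 1)))
      (\<lambda>(x, y). cmp (quotient_operad P R) n m i (R n `` {x}) (R m `` {y}))"
    by (rule continuous_map_eq) (auto simp: cmp_quotient_operad[OF R i])
qed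

text \<open>
  The composition of the quotient, precomposed with the projection of the product, is the
  composition of \<open>P\<close> followed by a projection; so it is continuous for the quotient topology of
  the product.
\<close>

lemma continuous_map_cmp_quotient_of_product:
  assumes P: "topological_operad P" and R: "operad_ideal P R" and i: "i \<in> {1..n}"
  shows "continuous_map
    (quotient_space (prod_topology (arity P n) (arity P m))
      {((S, T), (S', T')). (S, S') \<in> R n \<and> (T, T') \<in> R m})
    (arity (quotient_operad P R) (n + m - 1))
    (\<lambda>C. cmp (quotient_operad P R) n m i (fst ` C) (snd ` C))"
proof (rule continuous_compose_quotient_map[OF quotient_map_quotient_space])
  let ?Q = "{((S, T), (S', T')). (S, S') \<in> R n \<and> (T, T') \<in> R m}"
  show "continuous_map (prod_topology (arity P n) (arity P m))
      (arity (quotient_operad P R) (n + m - 1))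
      ((\<lambda>C. cmp (quotient_operad P R) n m i (fst ` C) (snd ` C)) \<circ> (\<lambda>x. ?Q `` {x}))"
  proof (rule continuous_map_eq[OF continuous_map_cmp_classes[OF P R i]])
    fix p assume "p \<in> topspace (prod_topology (arity P n) (arity P m))"
    then obtain x y where p: "p = (x, y)" and "x \<in> elems P n" "y \<in> elems P m" by auto
    then have "(x, x) \<in> R n" "(y, y) \<in> R m" using ideal_refl[OF R] by auto
    moreover have "?Q `` {(x, y)} = R n `` {x} \<times> R m `` {y}" by auto
    ultimately have "fst ` ?Q `` {(x, y)} = R n `` {x}" "snd ` ?Q `` {(x, y)} = R m `` {y}"
      by auto
    then show "(case p of (x, y) \<Rightarrow> cmp (quotient_operad P R) n m i (R n `` {x}) (R m `` {y})) =
        ((\<lambda>C. cmp (quotient_operad P R) n m i (fst ` C) (snd ` C)) \<circ> (\<lambda>x. ?Q `` {x})) p"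
      by (simp only: p prod.case o_apply)
  qed
qed

text \<open>
  The preimage of the image of a closed set is its saturation, and the fibres are the classes,
  which are compact because they are finite.
\<close>

lemma proper_map_quotient_space:
  assumes eq: "equiv (topspace X) R"
    and closed: "\<And>C. closedin X C \<Longrightarrow> closedin X (R `` C)"
    and fin: "\<And>x. x \<in> topspace X \<Longrightarrow> finite (R `` {x})"
  shows "proper_map X (quotient_space X R) (\<lambda>x. R `` {x})"
  unfolding proper_map_def
proof (intro conjI ballI)
  show "closed_map X (quotient_space X R) (\<lambda>x. R `` {x})"
    unfolding closed_map_def
  proof (intro allI impI)
    fix C assume C: "closedin X C"
    then have CX: "C \<subseteq> topspace X" by (rule closedin_subset)
    have "{x \<in> topspace X. R `` {x} \<in> (\<lambda>x. R `` {x}) ` C} = R `` C"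
    proof (intro equalityI subsetI)
      fix x assume "x \<in> {x \<in> topspace X. R `` {x} \<in> (\<lambda>x. R `` {x}) ` C}"
      then obtain c where "c \<in> C" "x \<in> topspace X" "R `` {c} = R `` {x}" by auto
      then have "(c, x) \<in> R" using eq CX by (meson eq_equiv_class)
      then show "x \<in> R `` C" using \<open>c \<in> C\<close> by blast
    next
      fix x assume "x \<in> R `` C"
      then obtain c where c: "c \<in> C" "(c, x) \<in> R" by blast
      then have "x \<in> topspace X" "R `` {c} = R `` {x}"
        using equiv_class_eq[OF eq c(2)] equivE[OF eq] c(2) by blast+
      then show "x \<in> {x \<in> topspace X. R `` {x} \<in> (\<lambda>x. R `` {x}) ` C}" using c by blast
    qed
    moreover have "(\<lambda>x. R `` {x}) ` C \<subseteq> topspace (quotient_space X R)"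
      using CX by (auto simp: quotientI)
    then have "closedin X {x \<in> topspace X. R `` {x} \<in> (\<lambda>x. R `` {x}) ` C} \<longleftrightarrow>
        closedin (quotient_space X R) ((\<lambda>x. R `` {x}) ` C)"
      using quotient_map_quotient_space[of X R] unfolding quotient_map_closedin by blast
    ultimately show "closedin (quotient_space X R) ((\<lambda>x. R `` {x}) ` C)"
      using closed[OF C] by simp
  qed
next
  fix K assume "K \<in> topspace (quotient_space X R)"
  then obtain a where a: "a \<in> topspace X" "K = R `` {a}" by (auto elim: quotientE)
  have "{x \<in> topspace X. R `` {x} = K} \<subseteq> R `` {a}"
  proof
    fix x assume "x \<in> {x \<in> topspace X. R `` {x} = K}"
    then show "x \<in> R `` {a}" using eq_equiv_class[OF _ eq, of a x] a(2) by simp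
  qed
  then show "compactin X {x \<in> topspace X. R `` {x} = K}"
    using fin[OF a(1)] by (intro finite_imp_compactin) (auto intro: finite_subset)
qed

text \<open>
  A product of proper maps is proper, hence closed, hence a quotient map if it is continuous and
  surjective. This is what a product of arbitrary quotient maps lacks.
\<close>

lemma topological_operad_quotient:
  assumes P: "topological_operad P" and R: "operad_ideal P R"
    and proper: "\<And>n. proper_map (arity P n) (quotient_space (arity P n) (R n)) (\<lambda>x. R n `` {x})"
  shows "topological_operad (quotient_operad P R)"
  unfolding topological_operad_def
proof (intro conjI allI impI)
  have "operad P" using P by (simp add: topological_operad_def)
  then show "operad (quotient_operad P R)" by (rule operad_quotient[OF _ R])
  show "continuous_map (arity (quotient_operad P R) n) (arity (quotient_operad P R) n)
      (act (quotient_operad P R) n s)" if "s permutes {1..n}" for n s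
    using continuous_map_act_quotient[OF P R that] .
next
  fix n m i assume i: "i \<in> {1..n::nat}"
  let ?q = "\<lambda>n x. R n `` {x}" and ?B = "\<lambda>n. quotient_space (arity P n) (R n)"
  let ?qq = "\<lambda>(x, y). (?q n x, ?q m y)"
  have "quotient_map (prod_topology (arity P n) (arity P m)) (prod_topology (?B n) (?B m)) ?qq"
  proof (rule continuous_closed_imp_quotient_map)
    show "continuous_map (prod_topology (arity P n) (arity P m)) (prod_topology (?B n) (?B m)) ?qq"
      using quotient_imp_continuous_map[OF quotient_map_quotient_space[of "arity P n" "R n"]]
        quotient_imp_continuous_map[OF quotient_map_quotient_space[of "arity P m" "R m"]]
      by (simp add: continuous_map_prod_top)
    show "closed_map (prod_topology (arity P n) (arity P m)) (prod_topology (?B n) (?B m)) ?qq"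
      using proper by (intro proper_imp_closed_map) (simp add: proper_map_prod)
    show "?qq ` topspace (prod_topology (arity P n) (arity P m)) = topspace (prod_topology (?B n) (?B m))"
      by (auto simp: quotient_def)
  qed
  moreover have "continuous_map (prod_topology (arity P n) (arity P m))
      (arity (quotient_operad P R) (n + m - 1))
      ((\<lambda>(x, y). cmp (quotient_operad P R) n m i x y) \<circ> ?qq)"
    using continuous_map_cmp_classes[OF P R i, of m] by (simp add: o_def case_prod_unfold)
  ultimately show "continuous_map
      (prod_topology (arity (quotient_operad P R) n) (arity (quotient_operad P R) m))
      (arity (quotient_operad P R) (n + m - 1)) (\<lambda>(x, y). cmp (quotient_operad P R) n m i x y)"
    unfolding arity_quotient_operad[of _ _ n] arity_quotient_operad[of _ _ m]
    by (rule continuous_compose_quotient_map)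
qed

section \<open>Finiteness of reduction classes and closedness of saturations\<close>

lemma finite_rooted_trees: "finite {T. rooted_tree {1..n} T}"
proof (rule finite_subset)
  show "{T. rooted_tree {1..n} T} \<subseteq> {1..n} \<times> Pow ({1..n} \<times> {1..n})"
    by (auto simp: rooted_tree_def)
qed simp

text \<open>
  The number \<open>n * n + 1\<close> is a crude bound for the number of labels of a tree on \<open>n\<close> vertices
  together with one additional label, the basepoint. The bound \<open>N\<close> has to be the same for all
  sets \<open>L\<close> of that size: the trees with labels in \<open>L\<close> are images of trees with numerical labels.
\<close>

lemma bounded_card_trees_with_labels:
  obtains N where "\<And>L :: 'y set. finite L \<Longrightarrow> card L \<le> Suc (n * n) \<Longrightarrow>
    finite {U. ytree_on {1..n} U \<and> snd ` labelled_edges U \<subseteq> L} \<and>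
    card {U. ytree_on {1..n} U \<and> snd ` labelled_edges U \<subseteq> L} \<le> N"
proof
  let ?M = "SIGMA t:{T. rooted_tree {1..n} T}. snd t \<rightarrow>\<^sub>E {..n * n}"
  have fin: "finite ?M"
  proof (intro finite_SigmaI finite_rooted_trees)
    fix t assume "t \<in> {T. rooted_tree {1..n} T}"
    then have "snd t \<subseteq> {1..n} \<times> {1..n}" by (auto simp: rooted_tree_def)
    then show "finite (snd t \<rightarrow>\<^sub>E {..n * n})" by (intro finite_PiE finite_subset[of "snd t"]) auto
  qed
  fix L :: "'y set" assume L: "finite L" "card L \<le> Suc (n * n)"
  let ?D = "{U. ytree_on {1..n} U \<and> snd ` labelled_edges U \<subseteq> L}"
  obtain c where c: "L \<subseteq> c ` {..n * n}"
  proof -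
    obtain c where "bij_betw c {0..<card L} L" using ex_bij_betw_nat_finite[OF L(1)] by blast
    then have "L = c ` {0..<card L}" by (simp add: bij_betw_def)
    also have "\<dots> \<subseteq> c ` {..n * n}" using L(2) by (intro image_mono) auto
    finally show ?thesis by (rule that)
  qed
  have "?D \<subseteq> (\<lambda>(t, w). (t, restrict (c \<circ> w) (snd t))) ` ?M"
  proof
    fix U assume "U \<in> ?D"
    then have U: "ytree_on {1..n} U" "snd ` labelled_edges U \<subseteq> L" by simp_all
    have img: "snd U e \<in> c ` {..n * n}" if "e \<in> snd (fst U)" for e
    proof -
      have "snd U e \<in> snd ` labelled_edges U" using that by (simp add: labelled_edges_def image_image)
      then show ?thesis using U(2) c by blast
    qed
    define w where "w e = inv_into {..n * n} c (snd U e)" for e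
    have w: "w e \<in> {..n * n}" "c (w e) = snd U e" if "e \<in> snd (fst U)" for e
      unfolding w_def by (rule inv_into_into[OF img[OF that]], rule f_inv_into_f[OF img[OF that]])
    have "(fst U, restrict w (snd (fst U))) \<in> ?M"
      using U(1) w by (auto simp: ytree_on_def)
    moreover have "snd U = restrict (c \<circ> restrict w (snd (fst U))) (snd (fst U))"
      using U(1) w by (intro extensionalityI[of _ "snd (fst U)"]) (auto simp: ytree_on_def)
    then have "U = (\<lambda>(t, w). (t, restrict (c \<circ> w) (snd t))) (fst U, restrict w (snd (fst U)))"
      by (simp add: prod_eq_iff)
    ultimately show "U \<in> (\<lambda>(t, w). (t, restrict (c \<circ> w) (snd t))) ` ?M" by (rule rev_image_eqI)
  qed
  then show "finite ?D \<and> card ?D \<le> card ?M"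
    using surj_card_le[OF fin] finite_subset finite_imageI[OF fin] by blast
qed

lemma labels_of_reduct:
  assumes "reduces b V T T'"
  shows "snd ` labelled_edges T' \<subseteq> insert b (snd ` labelled_edges T)"
    and "snd ` labelled_edges T \<subseteq> insert b (snd ` labelled_edges T')"
proof -
  obtain k i j y where ki: "((k, i), y) \<in> labelled_edges T"
    and T': "labelled_edges T' = insert ((k, j), y) (labelled_edges T - {((i, j), b)})"
    using assms unfolding reduces_def by blast
  have "y \<in> snd ` labelled_edges T" using ki by (rule rev_image_eqI) simp
  then show "snd ` labelled_edges T' \<subseteq> insert b (snd ` labelled_edges T)"
    unfolding T' by auto
  have "labelled_edges T \<subseteq> insert ((i, j), b) (labelled_edges T')" unfolding T' by blast
  from image_mono[OF this, of snd] show "snd ` labelled_edges T \<subseteq> insert b (snd ` labelled_edges T')"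
    by simp
qed

text \<open>
  A zigzag of reductions starting at \<open>T\<close> stays in the set \<open>D\<close> of trees whose labels are labels
  of \<open>T\<close> or \<open>b\<close>. The cardinality of \<open>D\<close> is at most \<open>N\<close>, so there are at most \<open>N * N\<close> pairs of
  consecutive trees, and a shortest zigzag has at most that length.
\<close>

lemma red_equiv_class_bounded:
  fixes b :: "'y::topological_space"
  obtains N where "\<And>T. ytree_on {1..n} T \<Longrightarrow> finite (red_equiv b n `` {T})"
    and "\<And>T T'. (T, T') \<in> red_equiv b n \<Longrightarrow>
      \<exists>k\<le>N. (T, T') \<in> {(U, U'). symclp (reduces b {1..n}) U U'} ^^ k"
proof -
  obtain N where N: "\<And>L :: 'y set. finite L \<Longrightarrow> card L \<le> Suc (n * n) \<Longrightarrow>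
      finite {U. ytree_on {1..n} U \<and> snd ` labelled_edges U \<subseteq> L} \<and>
      card {U. ytree_on {1..n} U \<and> snd ` labelled_edges U \<subseteq> L} \<le> N"
    using bounded_card_trees_with_labels[where 'y = 'y] by blast
  let ?Z = "{(U, U'). symclp (reduces b {1..n}) U U'}"
  have bound: "finite D \<and> card D \<le> N \<and> T \<in> D \<and> (\<forall>U U'. U \<in> D \<longrightarrow> (U, U') \<in> ?Z \<longrightarrow> U' \<in> D)"
    if T: "ytree_on {1..n} T"
      and D: "D = {U. ytree_on {1..n} U \<and> snd ` labelled_edges U \<subseteq> insert b (snd ` labelled_edges T)}"
    for T D
  proof (intro conjI allI impI)
    have "snd (fst T) \<subseteq> {1..n} \<times> {1..n}" using T by (auto simp: ytree_on_def rooted_tree_def)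
    then have E: "finite (snd (fst T))" "card (snd (fst T)) \<le> n * n"
      using finite_subset card_mono[of "{1..n} \<times> {1..n}"] by (auto simp: card_cartesian_product)
    have L: "snd ` labelled_edges T = snd T ` snd (fst T)" by (auto simp: labelled_edges_def image_image)
    have fin: "finite (insert b (snd ` labelled_edges T))" using E by (simp add: L)
    have "card (insert b (snd ` labelled_edges T)) \<le> Suc (card (snd T ` snd (fst T)))"
      unfolding L by (rule card_insert_le_m1) auto
    also have "\<dots> \<le> Suc (n * n)" using card_image_le[OF E(1), of "snd T"] E(2) by simp
    finally show "finite D" "card D \<le> N" using N[OF fin] unfolding D by blast+
    show "T \<in> D" using T unfolding D by auto
    fix U U' assume U: "U \<in> D" "(U, U') \<in> ?Z"
    then have "ytree_on {1..n} U'" by (auto simp: symclp_def reduces_def)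
    moreover have "snd ` labelled_edges U' \<subseteq> insert b (snd ` labelled_edges U)"
    proof -
      have "reduces b {1..n} U U' \<or> reduces b {1..n} U' U" using U(2) by (simp add: symclp_def)
      then show ?thesis by (elim disjE labels_of_reduct)
    qed
    ultimately show "U' \<in> D" using U(1) unfolding D by blast
  qed
  have reach: "T' \<in> D \<and> (T, T') \<in> (?Z \<inter> D \<times> D)\<^sup>*"
    if "(T, T') \<in> ?Z\<^sup>*" "T \<in> D" "\<forall>U U'. U \<in> D \<longrightarrow> (U, U') \<in> ?Z \<longrightarrow> U' \<in> D" for T T' D
    using that(1)
  proof (induction rule: rtrancl_induct)
    case (step U U')
    then have "(U, U') \<in> ?Z \<inter> D \<times> D" using that(3) by blast
    with step.IH show ?case by (blast intro: rtrancl_into_rtrancl)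
  qed (use that in simp)
  have star: "(T, T') \<in> ?Z\<^sup>*" if "(T, T') \<in> red_equiv b n" for T T'
  proof -
    have "(symclp (reduces b {1..n}))\<^sup>*\<^sup>* T T'"
      using that unfolding red_equiv_iff equivclp_def by blast
    then show ?thesis unfolding rtranclp_rtrancl_eq[symmetric] by simp
  qed
  have class_bound: "\<exists>D. finite D \<and> card D \<le> N \<and>
      (\<forall>T'. (T, T') \<in> red_equiv b n \<longrightarrow> T' \<in> D \<and> (T, T') \<in> (?Z \<inter> D \<times> D)\<^sup>*)"
    if T: "ytree_on {1..n} T" for T
  proof -
    obtain D where "finite D" "card D \<le> N" and D: "T \<in> D" "\<forall>U U'. U \<in> D \<longrightarrow> (U, U') \<in> ?Z \<longrightarrow> U' \<in> D"
      using bound[OF T refl] by blast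
    moreover have "T' \<in> D \<and> (T, T') \<in> (?Z \<inter> D \<times> D)\<^sup>*" if "(T, T') \<in> red_equiv b n" for T'
      by (rule reach[OF star[OF that] D])
    ultimately show ?thesis by blast
  qed
  show ?thesis
  proof
    fix T :: "'y ytree" assume "ytree_on {1..n} T"
    from class_bound[OF this] obtain D where "finite D" "red_equiv b n `` {T} \<subseteq> D" by blast
    then show "finite (red_equiv b n `` {T})" by (rule finite_subset[rotated])
  next
    fix T T' assume TT': "(T, T') \<in> red_equiv b n"
    then have "ytree_on {1..n} T" by (simp add: red_equiv_iff)
    from class_bound[OF this] TT' obtain D where D: "finite D" "card D \<le> N"
      and path: "(T, T') \<in> (?Z \<inter> D \<times> D)\<^sup>*" by blast
    let ?W = "?Z \<inter> D \<times> D"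
    have fin: "finite ?W" using D by blast
    have "card ?W \<le> card (D \<times> D)" using D by (intro card_mono) auto
    also have "\<dots> \<le> N * N" using D by (simp add: card_cartesian_product mult_le_mono)
    finally have W: "card ?W \<le> N * N" .
    obtain k where k: "k \<le> card ?W" "(T, T') \<in> ?W ^^ k"
      using path unfolding rtrancl_finite_eq_relpow[OF fin] by blast
    have "k \<le> N * N" using k(1) W by (rule order_trans)
    moreover have "(T, T') \<in> ?Z ^^ k" 
    proof (rule subsetD[OF _ k(2)])
      show "?W ^^ k \<subseteq> ?Z ^^ k"
        by (induction k) (simp_all add: relcomp_mono)
    qed
    ultimately show "\<exists>k\<le>N * N. (T, T') \<in> ?Z ^^ k" by blast
  qed
qed

text \<open>
  On labellings of fixed underlying trees a reduction is a map between products of copies of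
  \<open>Y\<close>, defined on the labellings with \<open>f (i, j) = b\<close>.
\<close>

lemma reduces_labelling_iff:
  fixes b :: "'y::topological_space"
  shows "reduces b {1..n} ((r, E), f) ((r', E'), f') \<longleftrightarrow>
     rooted_tree {1..n} (r, E) \<and> f \<in> extensional E \<and> r' = r \<and>
     (\<exists>k i j. (k, i) \<in> E \<and> (i, j) \<in> E \<and> f (i, j) = b \<and> E' = insert (k, j) (E - {(i, j)}) \<and>
        f' = restrict (f((k, j) := f (k, i))) E')"
proof -
  have "(\<exists>i j. (i, j) \<in> E \<and> i \<noteq> r \<and> f (i, j) = b \<and> ((r', E'), f') = reduct ((r, E), f) i j) \<longleftrightarrow>
     r' = r \<and> (\<exists>k i j. (k, i) \<in> E \<and> (i, j) \<in> E \<and> f (i, j) = b \<and> E' = insert (k, j) (E - {(i, j)}) \<and>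
        f' = restrict (f((k, j) := f (k, i))) E')" (is "?l \<longleftrightarrow> ?r")
    if tree: "rooted_tree {1..n} (r, E)"
  proof
    assume ?l
    then obtain i j where ij: "(i, j) \<in> E" "i \<noteq> r" "f (i, j) = b"
      "((r', E'), f') = reduct ((r, E), f) i j" by blast
    then have "(r, i) \<in> E\<^sup>*" using tree by (auto simp: rooted_tree_def)
    then obtain k where k: "(k, i) \<in> E" using ij(2) by (metis rtranclE)
    then show ?r using ij reduct_eq[OF tree k, of f j] by auto
  next
    assume ?r
    then obtain k i j where kij: "(k, i) \<in> E" "(i, j) \<in> E" "f (i, j) = b" "r' = r"
      "E' = insert (k, j) (E - {(i, j)})" "f' = restrict (f((k, j) := f (k, i))) E'" by blast
    then have "i \<noteq> r" using tree by (auto simp: rooted_tree_def)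
    then show ?l using kij reduct_eq[OF tree kij(1), of f j] 
      by (intro conjI exI[of _ i] exI[of _ j]) simp_all
  qed
  then show ?thesis
    unfolding red_step_eq_reduces[symmetric] red_step_def elems_NAP reducible_def ytree_on_def
    by (cases "rooted_tree {1..n} (r, E)") (simp_all del: One_nat_def)
qed

lemma closedin_nap_space:
  "closedin (nap_space n) C \<longleftrightarrow> (\<forall>T\<in>C. ytree_on {1..n} T) \<and>
     (\<forall>r E. rooted_tree {1..n} (r, E) \<longrightarrow> closedin (labellings E) {f. ((r, E), f) \<in> C})"
  unfolding nap_space_def closedin_sum_topology
  by (auto simp: ytree_on_def PiE_UNIV_domain PiE_def simp del: One_nat_def)

lemma topspace_labellings: "topspace (labellings E) = extensional E"
  by (auto simp: PiE_def)

lemma continuous_map_reduce_labels: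
  assumes "(k, i) \<in> E"
  shows "continuous_map (labellings E) (labellings (insert (k, j) (E - {(i, j)})))
    (\<lambda>f. restrict (f((k, j) := f (k, i))) (insert (k, j) (E - {(i, j)})))"
  unfolding continuous_map_componentwise
proof (intro conjI ballI)
  fix e assume e: "e \<in> insert (k, j) (E - {(i, j)})"
  show "continuous_map (labellings E) euclidean
      (\<lambda>f. restrict (f((k, j) := f (k, i))) (insert (k, j) (E - {(i, j)})) e)"
    using e continuous_map_product_projection[OF assms, of "\<lambda>_. euclidean"]
      continuous_map_product_projection[of e E "\<lambda>_. euclidean"]
    by (cases "e = (k, j)") auto
qed auto

lemma continuous_map_unreduce_labels:
  shows "continuous_map (labellings (insert (k, j) (E - {(i, j)}))) (labellings E)
    (\<lambda>f. restrict (f((i, j) := b)) E)"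
  unfolding continuous_map_componentwise
proof (intro conjI ballI)
  fix e assume e: "e \<in> E"
  show "continuous_map (labellings (insert (k, j) (E - {(i, j)}))) euclidean
      (\<lambda>f. restrict (f((i, j) := b)) E e)"
    using e continuous_map_product_projection[of e "insert (k, j) (E - {(i, j)})" "\<lambda>_. euclidean"]
    by (cases "e = (i, j)") auto
qed auto

text \<open>
  For fixed underlying tree and fixed \<open>k\<close>, \<open>i\<close>, \<open>j\<close>, this is the preimage of a closed set under
  a continuous map, intersected with the closed set \<open>f (i, j) = b\<close>. There are finitely many
  choices.
\<close>

lemma closedin_reducible_to:
  assumes haus: "Hausdorff_space (euclidean :: 'y topology)"
    and C: "closedin (nap_space n) (C :: 'y::topological_space ytree set)"
  shows "closedin (nap_space n) {T. \<exists>T'\<in>C. reduces b {1..n} T T'}"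
  unfolding closedin_nap_space
proof (intro conjI allI impI)
  show "\<forall>T\<in>{T. \<exists>T'\<in>C. reduces b {1..n} T T'}. ytree_on {1..n} T" by (auto simp: reduces_def)
  fix r E assume tree: "rooted_tree {1..n} (r, E)"
  let ?E = "\<lambda>(k, i, j). insert (k, j) (E - {(i, j)})"
  let ?red = "\<lambda>(k, i, j) f. restrict (f((k, j) := f (k, i))) (insert (k, j) (E - {(i, j)}))"
  let ?Q = "{(k, i, j). (k, i) \<in> E \<and> (i, j) \<in> E}"
  let ?C = "\<lambda>q. {f \<in> topspace (labellings E). f (snd q) = b} \<inter>
      {f \<in> topspace (labellings E). ?red q f \<in> {f'. ((r, ?E q), f') \<in> C}}"
  have "?Q \<subseteq> {1..n} \<times> {1..n} \<times> {1..n}" using tree by (auto simp: rooted_tree_def)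
  then have "finite ?Q" by (rule finite_subset) simp
  moreover have "closedin (labellings E) (?C q)" if qQ: "q \<in> ?Q" for q
  proof -
    obtain k i j where q: "q = (k, i, j)" and E: "(k, i) \<in> E" "(i, j) \<in> E" using qQ
      by (cases q rule: prod_cases3) auto
    have "closedin (labellings E) {f \<in> topspace (labellings E). f (i, j) = b}"
      by (rule closedin_continuous_maps_eq[OF haus])
        (use E in \<open>auto intro: continuous_map_product_projection\<close>)
    moreover have "closedin (labellings (?E q)) {f'. ((r, ?E q), f') \<in> C}"
      using C rooted_tree_move_up[OF tree E] unfolding closedin_nap_space q by simp
    then have "closedin (labellings E)
        {f \<in> topspace (labellings E). ?red q f \<in> {f'. ((r, ?E q), f') \<in> C}}"
      using closedin_continuous_map_preimage[OF continuous_map_reduce_labels[OF E(1), of j]]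
      unfolding q prod.case by blast
    ultimately show ?thesis unfolding q snd_conv by (rule closedin_Int)
  qed
  ultimately have "closedin (labellings E) (\<Union>q\<in>?Q. ?C q)" by (intro closedin_Union) auto
  also have "(\<Union>q\<in>?Q. ?C q) = {f. ((r, E), f) \<in> {T. \<exists>T'\<in>C. reduces b {1..n} T T'}}"
    unfolding topspace_labellings using tree 
    by (auto simp: reduces_labelling_iff Bex_def split_paired_Ex simp del: One_nat_def) blast+
  finally show "closedin (labellings E) \<dots>" .
qed

text \<open>
  A reduct forgets only the label of \<open>i \<rightarrow> j\<close>, which was \<open>b\<close>. So a labelling of a reduct with
  \<open>f (k, j) = f (k, i)\<close> comes from exactly one labelling, which depends continuously on it;
  conversely every labelling of a reduct satisfies that equation, a closed condition as \<open>Y\<close> is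
  Hausdorff.
\<close>

lemma closedin_reducts:
  assumes haus: "Hausdorff_space (euclidean :: 'y topology)"
    and C: "closedin (nap_space n) (C :: 'y::topological_space ytree set)"
  shows "closedin (nap_space n) {T'. \<exists>T\<in>C. reduces b {1..n} T T'}"
  unfolding closedin_nap_space
proof (intro conjI allI impI)
  show "\<forall>T\<in>{T'. \<exists>T\<in>C. reduces b {1..n} T T'}. ytree_on {1..n} T" by (auto simp: reduces_def)
  fix r E' assume tree': "rooted_tree {1..n} (r, E')"
  let ?Q = "{(E, k, i, j). rooted_tree {1..n} (r, E) \<and> (k, i) \<in> E \<and> (i, j) \<in> E \<and>
      E' = insert (k, j) (E - {(i, j)})}"
  let ?C = "\<lambda>(E, k, i, j). {f \<in> topspace (labellings E'). f (k, j) = f (k, i)} \<inter>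
      {f \<in> topspace (labellings E'). restrict (f((i, j) := b)) E \<in> {f. ((r, E), f) \<in> C}}"
  have "?Q \<subseteq> Pow ({1..n} \<times> {1..n}) \<times> {1..n} \<times> {1..n} \<times> {1..n}"
    by (auto simp: rooted_tree_def)
  then have "finite ?Q" by (rule finite_subset) simp
  moreover have "closedin (labellings E') (?C q)" if qQ: "q \<in> ?Q" for q
  proof -
    obtain E k i j where q: "q = (E, k, i, j)"
      and E: "rooted_tree {1..n} (r, E)" "(k, i) \<in> E" "(i, j) \<in> E"
      and E': "E' = insert (k, j) (E - {(i, j)})" using qQ
      by (cases q rule: prod_cases4) auto
    have "(k, j) \<in> E'" "(k, i) \<in> E'" using E edge_to_grandchild(1)[OF E] by (auto simp: E')
    then have "closedin (labellings E') {f :: _ \<Rightarrow> 'y. f \<in> topspace (labellings E') \<and> f (k, j) = f (k, i)}"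
      by (intro closedin_continuous_maps_eq[OF haus]) (auto intro: continuous_map_product_projection)
    moreover have "closedin (labellings E) {f. ((r, E), f) \<in> C}"
      using C E(1) unfolding closedin_nap_space by simp
    then have "closedin (labellings E')
        {f \<in> topspace (labellings E'). restrict (f((i, j) := b)) E \<in> {f. ((r, E), f) \<in> C}}"
      using closedin_continuous_map_preimage[OF continuous_map_unreduce_labels] unfolding E' by blast
    ultimately show ?thesis unfolding q prod.case by (rule closedin_Int)
  qed
  ultimately have "closedin (labellings E') (\<Union>q\<in>?Q. ?C q)" by (intro closedin_Union) auto
  also have "(\<Union>q\<in>?Q. ?C q) = {f. ((r, E'), f) \<in> {T'. \<exists>T\<in>C. reduces b {1..n} T T'}}" (is "?l = ?r")
  proof (intro equalityI subsetI)
    fix f' assume "f' \<in> ?l"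
    then obtain E k i j where E: "rooted_tree {1..n} (r, E)" "(k, i) \<in> E" "(i, j) \<in> E"
      and E': "E' = insert (k, j) (E - {(i, j)})" and f': "f' \<in> extensional E'" "f' (k, j) = f' (k, i)"
      and fC: "((r, E), restrict (f'((i, j) := b)) E) \<in> C"
      unfolding topspace_labellings by blast
    let ?f = "restrict (f'((i, j) := b)) E"
    have f'_eq: "f' = restrict (?f((k, j) := ?f (k, i))) E'"
    proof (rule extensionalityI[OF f'(1)])
      fix e assume "e \<in> E'"
      then show "f' e = restrict (?f((k, j) := ?f (k, i))) E' e"
        using f'(2) E edge_to_grandchild[OF E] by (auto simp: E')
    qed simp
    have "?f (i, j) = b" using E by simp
    then have "reduces b {1..n} ((r, E), ?f) ((r, E'), f')"
      unfolding reduces_labelling_iff using E E' f'_eq by (intro conjI exI) (assumption | simp)+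
    then show "f' \<in> ?r" using fC by blast
  next
    fix f' assume "f' \<in> ?r"
    then obtain r0 E f where C: "((r0, E), f) \<in> C" and "reduces b {1..n} ((r0, E), f) ((r, E'), f')"
      by auto
    then obtain k i j where E: "rooted_tree {1..n} (r, E)" "(k, i) \<in> E" "(i, j) \<in> E" and r: "r0 = r"
      and f: "f \<in> extensional E" "f (i, j) = b" and E': "E' = insert (k, j) (E - {(i, j)})"
      and f': "f' = restrict (f((k, j) := f (k, i))) E'"
      unfolding reduces_labelling_iff by blast
    have "restrict (f'((i, j) := b)) E = f"
    proof (rule extensionalityI[OF _ f(1)])
      fix e assume "e \<in> E"
      then show "restrict (f'((i, j) := b)) E e = f e"
        using f(2) edge_to_grandchild[OF E] by (auto simp: f' E')
    qed simp
    moreover have "f' (k, j) = f' (k, i)" using E edge_to_grandchild[OF E] by (auto simp: f' E')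
    moreover have "f' \<in> extensional E'" by (simp add: f')
    ultimately have "f' \<in> ?C (E, k, i, j)" using C by (simp add: r PiE_UNIV_domain PiE_iff)
    then show "f' \<in> ?l" using E E' by blast
  qed
  finally show "closedin (labellings E') \<dots>" .
qed

text \<open>
  Without the bound on the number of steps the saturation would be an infinite union of closed
  sets, which need not be closed.
\<close>

lemma closedin_red_equiv_saturation:
  assumes haus: "Hausdorff_space (euclidean :: 'y topology)"
    and C: "closedin (nap_space n) (C :: 'y::topological_space ytree set)"
  shows "closedin (nap_space n) (red_equiv b n `` C)"
proof -
  let ?Z = "{(U, U'). symclp (reduces b {1..n}) U U'}"
  obtain N where N: "\<And>T T'. (T, T') \<in> red_equiv b n \<Longrightarrow> \<exists>k\<le>N. (T, T') \<in> ?Z ^^ k"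
    using red_equiv_class_bounded by metis
  have step: "closedin (nap_space n) (?Z `` D)" if D: "closedin (nap_space n) D" for D
  proof -
    have "?Z `` D = {T'. \<exists>T\<in>D. reduces b {1..n} T T'} \<union> {T. \<exists>T'\<in>D. reduces b {1..n} T T'}"
      by (auto simp: symclp_def)
    then show ?thesis
      by (simp only:) (intro closedin_Un closedin_reducts[OF haus D] closedin_reducible_to[OF haus D])
  qed
  have pow: "closedin (nap_space n) ((?Z ^^ k) `` C)" for k
  proof (induction k)
    case (Suc k)
    have "(?Z ^^ Suc k) `` C = ?Z `` ((?Z ^^ k) `` C)" by auto
    with step[OF Suc.IH] show ?case by simp
  qed (use C in simp)
  have "red_equiv b n `` C = (\<Union>k\<le>N. (?Z ^^ k) `` C)"
  proof (intro equalityI subsetI)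
    fix T' assume "T' \<in> red_equiv b n `` C"
    then show "T' \<in> (\<Union>k\<le>N. (?Z ^^ k) `` C)" using N by blast
  next
    fix T' assume "T' \<in> (\<Union>k\<le>N. (?Z ^^ k) `` C)"
    then obtain k T where T: "T \<in> C" "(T, T') \<in> ?Z ^^ k" by blast
    then have "(T, T') \<in> ?Z\<^sup>*" by (simp add: relpow_imp_rtrancl)
    then have "equivclp (reduces b {1..n}) T T'"
      unfolding equivclp_def rtranclp_rtrancl_eq by simp
    moreover have "ytree_on {1..n} T" using C T(1) by (simp add: closedin_nap_space)
    moreover have "ytree_on {1..n} T'"
    proof -
      have "T' \<in> (?Z ^^ k) `` C" using T by blast
      then show ?thesis using pow[of k] by (simp add: closedin_nap_space)
    qed
    ultimately show "T' \<in> red_equiv b n `` C" using T(1) by (auto simp: red_equiv_iff)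
  qed
  moreover have "closedin (nap_space n) (\<Union>k\<le>N. (?Z ^^ k) `` C)"
    using pow by (intro closedin_Union) auto
  ultimately show ?thesis by simp
qed

lemma topological_operad_BCact:
  assumes "Hausdorff_space (euclidean :: 'y topology)"
  shows "topological_operad (BCact (b :: 'y::topological_space))"
  unfolding BCact_def
proof (rule topological_operad_quotient[OF topological_operad_NAP operad_ideal_red_equiv])
  fix n
  obtain N where fin: "\<And>T. ytree_on {1..n} T \<Longrightarrow> finite (red_equiv b n `` {T})"
    using red_equiv_class_bounded by metis
  show "proper_map (arity NAP n) (quotient_space (arity NAP n) (red_equiv b n)) (BCact_proj b n)"
    using closedin_red_equiv_saturation[OF assms, of n _ b] fin
    by (intro proper_map_quotient_space ideal_equiv[OF operad_ideal_red_equiv])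
      (simp_all add: arity_NAP[symmetric] elems_NAP del: One_nat_def)
qed

section \<open>The operad BCact\<close>

theorem theorem3p2:
  fixes b :: "'y::topological_space"
  shows "operad_ideal NAP (red_equiv b) \<and>
    operad (BCact b) \<and>
    operad_morphism NAP (BCact b) (BCact_proj b) \<and>
    (\<forall>n. quotient_map (arity NAP n) (arity (BCact b) n) (BCact_proj b n)) \<and>
    (\<forall>n s. s permutes {1..n} \<longrightarrow>
       continuous_map (arity (BCact b) n) (arity (BCact b) n) (act (BCact b) n s)) \<and>
    (\<forall>n m i. i \<in> {1..n} \<longrightarrow>
       continuous_map
         (quotient_space (prod_topology (arity NAP n) (arity NAP m))
            {((S, T), (S', T')). (S, S') \<in> red_equiv b n \<and> (T, T') \<in> red_equiv b m})
         (arity (BCact b) (n + m - 1))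
         (\<lambda>C. cmp (BCact b) n m i (fst ` C) (snd ` C))) \<and>
    (Hausdorff_space (euclidean :: 'y topology) \<longrightarrow> topological_operad (BCact b)) \<and>
    (\<forall>n. red_equiv b n = generated_ideal NAP (basic_relation b) n)"
proof (intro conjI allI impI)
  note ideal = operad_ideal_red_equiv[of b]
  show "operad_ideal NAP (red_equiv b)" by (fact ideal)
  show "operad (BCact b)" "operad_morphism NAP (BCact b) (BCact_proj b)"
    unfolding BCact_def
    using operad_quotient[OF operad_NAP ideal] operad_morphism_quotient[OF operad_NAP ideal] by blast+
  show "quotient_map (arity NAP n) (arity (BCact b) n) (BCact_proj b n)" for n
    unfolding BCact_def arity_quotient_operad by (rule quotient_map_quotient_space)
  show "continuous_map (arity (BCact b) n) (arity (BCact b) n) (act (BCact b) n s)"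
    if "s permutes {1..n}" for n s
    unfolding BCact_def by (rule continuous_map_act_quotient[OF topological_operad_NAP ideal that])
  show "continuous_map
      (quotient_space (prod_topology (arity NAP n) (arity NAP m))
        {((S, T), (S', T')). (S, S') \<in> red_equiv b n \<and> (T, T') \<in> red_equiv b m})
      (arity (BCact b) (n + m - 1)) (\<lambda>C. cmp (BCact b) n m i (fst ` C) (snd ` C))"
    if "i \<in> {1..n}" for n m i
    unfolding BCact_def
    by (rule continuous_map_cmp_quotient_of_product[OF topological_operad_NAP ideal that])
  show "topological_operad (BCact b)" if "Hausdorff_space (euclidean :: 'y topology)"
    by (rule topological_operad_BCact[OF that])
  show "red_equiv b n = generated_ideal NAP (basic_relation b) n" for n
    by (rule generated_ideal_basic_relation[symmetric])
qed

end
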